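(* Let $\upsilon_\perp\in\mathbb R^{m\times(m-h)}$ have full column rank, where $h\le F$, and suppose the null hypothesis $\upsilon_\perp^{\mathsf T}U_I=0$ holds. Define $$B_{\mathrm{SVD}}=\left(\Sigma_I^{-1\mathsf T}V_I^{\mathsf T}\otimes\upsilon_\perp^{\mathsf T}U_JU_J^{\mathsf T}\right)+\left(I_F\otimes\upsilon_\perp^{\mathsf T}U_I\right)\left[\left(\mathbf 1^{\mathsf T}\otimes\operatorname{vec}D_{\mathrm d}\right)\circ\left(\left(\Sigma_I^{\mathsf T}V_I^{\mathsf T}\otimes U_I^{\mathsf T}\right)+\left(U_I^{\mathsf T}\otimes\Sigma_IV_I^{\mathsf T}\right)K\right)\right],$$ let $\hat B_{\mathrm{SVD}}$ be its sample analogue, $\hat\Omega_S=\hat B_{\mathrm{SVD}}\hat\Omega\hat B_{\mathrm{SVD}}^{\mathsf T}$, and let $\hat\Omega_S^+$ be the generalized inverse of $\hat\Omega_S$. Then, as $T\to\infty$, $$\hat W_{\mathrm{SVD}}(\upsilon_\perp)=T\,\operatorname{vec}\left(\upsilon_\perp^{\mathsf T}\hat U_I\right)^{\mathsf T}\hat\Omega_S^{+}\operatorname{vec}\left(\upsilon_\perp^{\mathsf T}\hat U_I\right)$$ converges in distribution to a $\chi^2_{q(m-h)}$ random variable.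
   Context: $M\in\mathbb R^{m\times l}$ with $m\le l$ has rank $q\le m$, and $F=q$ denotes this rank. Its singular value decomposition splits as $M=U_I\Sigma_IV_I^{\mathsf T}+U_J\Sigma_JV_J^{\mathsf T}$ with $\Sigma_J=0$, $\Sigma_I=\operatorname{diag}(\iota_1,\dots,\iota_q)$ the positive singular values (distinct, so that $D_{\mathrm d}$ below is defined), $U_I\in\mathbb R^{m\times q}$, $V_I\in\mathbb R^{l\times q}$ with orthonormal columns, and $[U_I\ U_J]$ orthogonal. $D_{\mathrm d}\in\mathbb R^{q\times q}$ has entries $(\iota_i^2-\iota_j^2)^{-1}$ for $i\ne j$ and zero diagonal; $\circ$ is the Hadamard product; $\mathbf 1\in\mathbb R^{ml}$ is the vector of ones; $K$ is the commutation matrix with $\operatorname{vec}(E^{\mathsf T})=K\operatorname{vec}E$ for $E\in\mathbb R^{m\times l}$. Data: $M_t=M+\varepsilon_t$, $t=1,\dots,T$, where $\operatorname{vec}\varepsilon_t$ are identically distributed with mean zero and positive-definite covariance $\Omega\in\mathbb R^{ml\times ml}$; $\hat M_T=T^{-1}\sum_tM_t$ and $\sqrt T\operatorname{vec}(\hat M_T-M)$ converges in distribution to $N(0,\Omega)$; $\hat\Omega$ is a consistent estimator of $\Omega$. Hatted quantities are sample analogues computed from the singular value decomposition of $\hat M_T$, with $\hat U_I,\hat\Sigma_I,\hat V_I$ belonging to its $q$ largest singular values. The generalized inverse of a matrix $A$ with nonzero singular values $\iota_i$ and singular vectors $u_i,v_i$ is $A^+=\sum_i\iota_i^{-1}v_iu_i^{\mathsf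 T}$. *)

theory Defs
  imports "HOL-Probability.Probability"
begin

text \<open>An \<open>m \<times> n\<close> real matrix has type \<^typ>\<open>real^'n^'m\<close>. Vectors of length \<open>m n\<close> and
  Kronecker products are indexed by pairs, ordered so that the usual column-stacking identities
  hold: the entry \<open>(j, i)\<close> of \<open>vec_of A\<close> is \<open>A $ i $ j\<close>, the column index coming first.\<close>

definition vec_of :: "real^'n^'m \<Rightarrow> real^('n::finite \<times> 'm::finite)" where
  "vec_of A = (\<chi> p. A $ snd p $ fst p)"

definition kron :: "real^'b^'a \<Rightarrow> real^'d^'c \<Rightarrow> real^('b::finite \<times> 'd::finite)^('a::finite \<times> 'c::finite)" (infixl "\<otimes>\<^sub>K" 72) where
  "A \<otimes>\<^sub>K B = (\<chi> p r. A $ fst p $ fst r * B $ snd p $ snd r)"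

definition hadamard :: "real^'n^'m \<Rightarrow> real^'n^'m \<Rightarrow> real^'n^'m" (infixl "\<circ>\<^sub>H" 70) where
  "A \<circ>\<^sub>H B = (\<chi> i j. A $ i $ j * B $ i $ j)"

definition outer :: "real^'m \<Rightarrow> real^'n \<Rightarrow> real^'n^'m" where
  "outer u v = (\<chi> i j. u $ i * v $ j)"

text \<open>\<open>outer v 1\<close> is the Kronecker product of the row vector of ones with the column vector \<open>v\<close>
  (every column equals \<open>v\<close>); it is typed without the one-element index factors of a literal
  Kronecker product.\<close>

definition commutation :: "real^('l::finite \<times> 'm::finite)^('m \<times> 'l)" where
  "commutation = (\<chi> p r. if fst p = snd r \<and> snd p = fst r then 1 else 0)"

lemma vec_of_transpose:
  fixes E :: "real^'l^'m"
  shows "vec_of (transpose E) = commutation *v vec_of E"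
proof -
  have "(commutation *v vec_of E) $ p = vec_of (transpose E) $ p" for p
  proof -
    have "(commutation *v vec_of E) $ p =
        (\<Sum>r\<in>UNIV. if r = (snd p, fst p) then vec_of E $ r else 0)"
      unfolding matrix_vector_mult_def commutation_def
      by (auto intro!: sum.cong simp: prod_eq_iff)
    also have "\<dots> = vec_of (transpose E) $ p"
      by (simp add: vec_of_def transpose_def)
    finally show ?thesis .
  qed
  then show ?thesis by (simp add: vec_eq_iff)
qed

lemma vec_of_mult:
  fixes A :: "real^'b^'a" and X :: "real^'c^'b" and B :: "real^'d^'c"
  shows "vec_of (A ** X ** B) = (transpose B \<otimes>\<^sub>K A) *v vec_of X"
proof -
  have "vec_of (A ** X ** B) $ p = ((transpose B \<otimes>\<^sub>K A) *v vec_of X) $ p" for p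
  proof -
    have "vec_of (A ** X ** B) $ p =
        (\<Sum>k\<in>UNIV. \<Sum>i\<in>UNIV. B $ k $ fst p * A $ snd p $ i * X $ i $ k)"
      by (simp add: vec_of_def matrix_matrix_mult_def sum_distrib_left sum_distrib_right mult_ac)
    also have "\<dots> = ((transpose B \<otimes>\<^sub>K A) *v vec_of X) $ p"
      by (simp add: vec_of_def kron_def matrix_vector_mult_def transpose_def
          sum.cartesian_product UNIV_Times_UNIV[symmetric] case_prod_beta del: UNIV_Times_UNIV)
    finally show ?thesis .
  qed
  then show ?thesis by (simp add: vec_eq_iff)
qed

definition diag :: "real^'n \<Rightarrow> real^'n^'n" where
  "diag s = (\<chi> i j. if i = j then s $ i else 0)"

definition hcat :: "real^'a^'m \<Rightarrow> real^'b^'m \<Rightarrow> real^('a::finite + 'b::finite)^'m" where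
  "hcat A B = (\<chi> i k. case k of Inl a \<Rightarrow> A $ i $ a | Inr b \<Rightarrow> B $ i $ b)"

definition orthonormal_cols :: "real^'n^'m \<Rightarrow> bool" where
  "orthonormal_cols A \<longleftrightarrow> transpose A ** A = mat 1"

definition pos_def :: "real^'n^'n \<Rightarrow> bool" where
  "pos_def A \<longleftrightarrow> transpose A = A \<and> (\<forall>x. x \<noteq> 0 \<longrightarrow> 0 < x \<bullet> (A *v x))"

text \<open>A split singular value decomposition of an \<open>m \<times> l\<close> matrix, \<open>m \<le> l\<close>, in which the block \<open>I\<close>
  carries the largest singular values. The block matrix \<open>hcat UI UJ\<close> is orthogonal as an
  \<open>m \<times> m\<close> matrix; its column index type is the sum type, so both products are required to be the
  identity (and hence \<open>CARD('q) + CARD('j) = CARD('m)\<close>). The right factor is thin: only the first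
  \<open>m\<close> right singular vectors appear, since any further ones are multiplied by zero. The order of
  the singular values within a block is left free.\<close>

definition is_split_svd ::
  "real^'l^'m \<Rightarrow> real^'q^'m \<Rightarrow> real^'q \<Rightarrow> real^'q^'l \<Rightarrow> real^'j^'m \<Rightarrow> real^'j \<Rightarrow> real^'j^'l \<Rightarrow> bool" where
  "is_split_svd M UI sI VI UJ sJ VJ \<longleftrightarrow>
     orthonormal_cols (hcat UI UJ) \<and> orthonormal_cols (transpose (hcat UI UJ)) \<and>
     orthonormal_cols (hcat VI VJ) \<and>
     (\<forall>a. 0 \<le> sI $ a) \<and> (\<forall>b. 0 \<le> sJ $ b) \<and> (\<forall>a b. sJ $ b \<le> sI $ a) \<and>
     M = UI ** diag sI ** transpose VI + UJ ** diag sJ ** transpose VJ"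

text \<open>\<open>\<Sum>\<^sub>i \<iota>\<^sub>i\<^sup>-\<^sup>1 v\<^sub>i u\<^sub>i\<^sup>T\<close> for \<open>A = \<Sum>\<^sub>i \<iota>\<^sub>i u\<^sub>i v\<^sub>i\<^sup>T\<close> with \<open>\<iota>\<^sub>i > 0\<close>; the value does not depend on
  the choice of the decomposition.\<close>

definition ginv :: "real^'n^'m \<Rightarrow> real^'m^'n" where
  "ginv A = (THE X. \<exists>(r::nat) (s :: nat \<Rightarrow> real) u v.
     (\<forall>i<r. 0 < s i) \<and>
     (\<forall>i<r. \<forall>j<r. u i \<bullet> u j = (if i = j then 1 else 0)) \<and>
     (\<forall>i<r. \<forall>j<r. v i \<bullet> v j = (if i = j then 1 else 0)) \<and>
     A = (\<Sum>i<r. s i *\<^sub>R outer (u i) (v i)) \<and>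
     X = (\<Sum>i<r. inverse (s i) *\<^sub>R outer (v i) (u i)))"

definition D_d :: "real^'q \<Rightarrow> real^'q^'q" where
  "D_d s = (\<chi> i j. if i = j then 0 else inverse ((s $ i)\<^sup>2 - (s $ j)\<^sup>2))"

definition B_SVD ::
  "real^'r^'m \<Rightarrow> real^'q^'m \<Rightarrow> real^'q \<Rightarrow> real^'q^'l \<Rightarrow> real^'j^'m \<Rightarrow> real^('l \<times> 'm)^('q \<times> 'r)" where
  "B_SVD \<upsilon> UI sI VI UJ =
     (transpose (matrix_inv (diag sI)) ** transpose VI) \<otimes>\<^sub>K (transpose \<upsilon> ** UJ ** transpose UJ)
     + (mat 1 \<otimes>\<^sub>K (transpose \<upsilon> ** UI)) **
       (outer (vec_of (D_d sI)) 1 \<circ>\<^sub>H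
         ((transpose (diag sI) ** transpose VI) \<otimes>\<^sub>K transpose UI
          + (transpose UI \<otimes>\<^sub>K (diag sI ** transpose VI)) ** commutation))"

definition sample_mean :: "(nat \<Rightarrow> 'w \<Rightarrow> real^'l^'m) \<Rightarrow> nat \<Rightarrow> 'w \<Rightarrow> real^'l^'m" where
  "sample_mean Mt T \<omega> = (1 / real T) *\<^sub>R (\<Sum>t = 1..T. Mt t \<omega>)"

text \<open>\<open>W_SVD\<close> takes the estimated decomposition and the estimate \<open>Om\<close> of the covariance matrix.\<close>

definition W_SVD ::
  "nat \<Rightarrow> real^'r^'m \<Rightarrow> real^'q^'m \<Rightarrow> real^'q \<Rightarrow> real^'q^'l \<Rightarrow> real^'j^'m
    \<Rightarrow> real^('l \<times> 'm)^('l \<times> 'm) \<Rightarrow> real" where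
  "W_SVD T \<upsilon> UI sI VI UJ Om =
     (let B = B_SVD \<upsilon> UI sI VI UJ;
          OmS = B ** Om ** transpose B;
          d = vec_of (transpose \<upsilon> ** UI)
      in real T * (d \<bullet> (ginv OmS *v d)))"

text \<open>The centred normal distribution with covariance matrix \<open>S\<close>; meaningful for \<open>pos_def S\<close>.\<close>

definition mvn :: "real^'n^'n \<Rightarrow> (real^'n) measure" where
  "mvn S = density lborel (\<lambda>x. ennreal
     (exp (- (x \<bullet> (matrix_inv S *v x)) / 2) / sqrt ((2 * pi) ^ CARD('n) * det S)))"

definition chi_squared :: "nat \<Rightarrow> real measure" where
  "chi_squared k =
     distr (\<Pi>\<^sub>M i\<in>{..<k}. density lborel std_normal_density) borel (\<lambda>x. \<Sum>i<k. (x i)\<^sup>2)"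

definition conv_in_distr ::
  "'w measure \<Rightarrow> (nat \<Rightarrow> 'w \<Rightarrow> 'a::euclidean_space) \<Rightarrow> 'a measure \<Rightarrow> bool" where
  "conv_in_distr P X \<mu> \<longleftrightarrow>
     (\<forall>f :: 'a \<Rightarrow> real. continuous_on UNIV f \<and> bounded (range f) \<longrightarrow>
        (\<lambda>n. \<integral>\<omega>. f (X n \<omega>) \<partial>P) \<longlonglongrightarrow> (\<integral>x. f x \<partial>\<mu>))"

definition conv_in_prob ::
  "'w measure \<Rightarrow> (nat \<Rightarrow> 'w \<Rightarrow> 'a::euclidean_space) \<Rightarrow> 'a \<Rightarrow> bool" where
  "conv_in_prob P X c \<longleftrightarrow>
     (\<forall>e>0. (\<lambda>n. measure P {\<omega> \<in> space P. e < dist (X n \<omega>) c}) \<longlonglongrightarrow> 0)"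

end

theory Submission
  imports Defs
begin

text \<open>
Why the theorem holds. Write \<open>x = vec (Mh - M)\<close> for the estimation error of the sample mean \<open>Mh\<close>. The
null hypothesis gives \<open>\<upsilon>\<^sup>T M = 0\<close>, so multiplying \<open>Mh V\<^sub>I = U\<^sub>I \<Sigma>\<^sub>I\<close> (for the sample decomposition) by
\<open>\<upsilon>\<^sup>T\<close> shows that the estimated contrast is an exactly linear function \<open>vec (\<upsilon>\<^sup>T U\<^sub>I) = A x\<close> of the error,
with \<open>A = \<Sigma>\<^sub>I\<^sup>-\<^sup>1 V\<^sub>I\<^sup>T \<otimes> \<upsilon>\<^sup>T\<close> (\<open>contrast_linear_in_error\<close>). The statistic is thus \<open>T\<close> times the quadratic
form \<open>x\<^sup>T A\<^sup>T (B \<Omega>' B\<^sup>T)\<^sup>+ A x\<close>, where \<open>\<Omega>'\<close> is the estimate of \<open>\<Omega>\<close>.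

The sample singular vectors need not converge, since their order and signs are arbitrary. Any limit
point of them, however, is a decomposition of \<open>M\<close> with the same distinct positive singular values up
to order (\<open>split_svd_limit\<close>, \<open>split_svd_unique_up_to_rotation\<close>). Along a convergent subsequence \<open>A\<close>
and \<open>B\<close> have the common limit \<open>R C\<close>, where \<open>C = V\<^sub>I\<^sup>T \<otimes> \<upsilon>\<^sup>T\<close> belongs to \<open>M\<close> and \<open>R\<close> is invertible, and
\<open>R\<close> drops out of the quadratic form (\<open>projected_form_invariant\<close>). By compactness, the form above
differs from \<open>\<phi> x = (C x)\<^sup>T (C \<Omega> C\<^sup>T)\<^sup>-\<^sup>1 (C x)\<close> by at most \<open>\<eta> \<bar>x\<bar>\<^sup>2\<close> whenever \<open>Mh\<close> and \<open>\<Omega>'\<close> are close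
enough to \<open>M\<close> and \<open>\<Omega>\<close> (\<open>statistic_uniform_approximation\<close>). This takes the place of an asymptotic
expansion of singular vectors.

With \<open>Z = sqrt T x\<close>, which converges in distribution to \<open>N(0, \<Omega>)\<close>, the statistic is \<open>\<phi> Z\<close> up to an
error of at most \<open>\<eta> \<bar>Z\<bar>\<^sup>2\<close>, outside events of vanishing probability; such an error is invisible in the
limit (\<open>weak_conv_of_quadratic_approximation\<close>). Finally \<open>\<phi>\<close> maps \<open>N(0, \<Omega>)\<close> to the chi-squared law
whose degrees of freedom are the number \<open>q (m - h)\<close> of rows of \<open>C\<close>: a linear change of coordinates makes
the Gaussian standard and \<open>\<phi>\<close> a sum of squares of that many coordinates (\<open>distr_mvn_quadratic_form\<close>).

The statistic must also be measurable for each \<open>T\<close>, including where the estimated covariance of the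
contrast is singular. The generalized inverse is therefore exhibited as a pointwise limit of regularised
inverses (\<open>ginv_limit\<close>), which at the same time shows that it does not depend on the chosen
decomposition.
\<close>

section \<open>Orthonormal eigenvectors and the generalized inverse\<close>

lemma outer_mult_vec: "outer u v *v x = (v \<bullet> x) *\<^sub>R u"
  by (simp add: vec_eq_iff matrix_vector_mult_def outer_def inner_vec_def sum_distrib_left mult_ac)

lemma matrix_mult_outer: "A ** outer u v = outer (A *v u) v"
  by (simp add: vec_eq_iff matrix_matrix_mult_def matrix_vector_mult_def outer_def
      sum_distrib_right sum_distrib_left mult_ac)

lemma transpose_outer: "transpose (outer u v) = outer v u"
  by (simp add: vec_eq_iff transpose_def outer_def mult_ac)

lemma outer_scaleR_left: "outer (c *\<^sub>R u) v = c *\<^sub>R outer u v"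
  by (simp add: vec_eq_iff outer_def)

lemma sum_mult_vec: "(\<Sum>i\<in>I. A i) *v x = (\<Sum>i\<in>I. (A i :: real^'n^'m) *v x)"
  by (induction I rule: infinite_finite_induct) (auto simp: matrix_vector_mult_add_rdistrib)

lemma scaleR_mult_vec: "(c *\<^sub>R A) *v x = c *\<^sub>R (A *v x :: real^'m)"
  by (simp add: scaleR_matrix_vector_assoc)

lemma matrix_mult_sum_right: "A ** (\<Sum>i\<in>I. X i) = (\<Sum>i\<in>I. A ** (X i :: real^'p^'n))"
  for A :: "real^'n^'m"
  by (induction I rule: infinite_finite_induct) (auto simp: matrix_add_ldistrib)

lemma transpose_sum: "transpose (\<Sum>i\<in>I. A i) = (\<Sum>i\<in>I. transpose (A i :: real^'n^'m))"
  by (simp add: vec_eq_iff transpose_def)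

lemma inner_mult_vec: "x \<bullet> (A *v y) = (transpose A *v x) \<bullet> y" for A :: "real^'n^'m"
  by (simp add: dot_lmul_matrix)

text \<open>The index set is an initial segment of the naturals rather than the index type, so that a family can
be completed to a basis one vector at a time by induction on its length.\<close>

definition orthonormal_family :: "nat \<Rightarrow> (nat \<Rightarrow> real^'n) \<Rightarrow> bool" where
  "orthonormal_family k e \<longleftrightarrow> (\<forall>i<k. \<forall>j<k. e i \<bullet> e j = (if i = j then 1 else 0))"

lemma orthonormal_familyD:
  "orthonormal_family k e \<Longrightarrow> i < k \<Longrightarrow> j < k \<Longrightarrow> e i \<bullet> e j = (if i = j then 1 else 0)"
  by (auto simp: orthonormal_family_def)

lemma orthonormal_family_independent:
  fixes e :: "nat \<Rightarrow> real^'n"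
  assumes "orthonormal_family k e"
  shows "independent (e ` {..<k})" "card (e ` {..<k}) = k"
proof -
  have inj: "inj_on e {..<k}"
  proof (rule inj_onI)
    fix i j assume "i \<in> {..<k}" "j \<in> {..<k}" "e i = e j"
    then show "i = j" using orthonormal_familyD[OF assms, of i i] orthonormal_familyD[OF assms, of i j]
      by (auto split: if_splits)
  qed
  then show "card (e ` {..<k}) = k" by (simp add: card_image)
  have "0 \<notin> e ` {..<k}"
    using assms by (force simp: orthonormal_family_def)
  moreover have "pairwise orthogonal (e ` {..<k})"
    using assms by (auto simp: pairwise_def orthogonal_def orthonormal_family_def)
  ultimately show "independent (e ` {..<k})"
    using pairwise_orthogonal_independent by blast
qed

lemma orthonormal_family_le: "orthonormal_family k e \<Longrightarrow> k \<le> CARD('n)"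
  for e :: "nat \<Rightarrow> real^'n"
  using orthonormal_family_independent[of k e] independent_card_le_dim[of "e ` {..<k}" UNIV]
  by simp

text \<open>A maximiser of \<open>x\<^sup>T A x\<close> over the unit vectors orthogonal to the given eigenvectors is an eigenvector:
the orthogonal complement is invariant under \<open>A\<close>, so the component \<open>w\<close> of \<open>A x\<close> orthogonal to \<open>x\<close>
is an admissible direction, and it must vanish at the maximum.\<close>

lemma eigenvector_orthogonal_to:
  fixes A :: "real^'n^'n"
  assumes sym: "transpose A = A" and on: "orthonormal_family k e"
    and eig: "\<forall>i<k. A *v e i = l i *\<^sub>R e i" and k: "k < CARD('n)"
  obtains x c where "norm x = 1" "\<forall>i<k. e i \<bullet> x = 0" "A *v x = c *\<^sub>R x"
proof -
  have adj: "y \<bullet> (A *v z) = (A *v y) \<bullet> z" for y z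
    using inner_mult_vec[of y A z] sym by metis
  define S where "S = {x. \<forall>i<k. e i \<bullet> x = 0}"
  have "dim (e ` {..<k}) < CARD('n)"
    using k orthonormal_family_independent[OF on] by (simp add: dim_eq_card_independent)
  then have "dim (e ` {..<k}) < DIM(real^'n)" by simp
  from orthogonal_to_subspace_exists[OF this]
  obtain y where "y \<noteq> 0" and y: "\<And>z. z \<in> span (e ` {..<k}) \<Longrightarrow> orthogonal y z" by blast
  have "y /\<^sub>R norm y \<in> S \<inter> sphere 0 1"
    using y[OF span_base, of "e _"] \<open>y \<noteq> 0\<close> by (auto simp: S_def orthogonal_def inner_commute[of y])
  then have ne: "S \<inter> sphere 0 1 \<noteq> {}" by blast
  have "closed S"
    unfolding S_def by (intro closed_Collect_all closed_Collect_imp closed_Collect_eq) 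
      (auto intro!: continuous_intros)
  then have comp: "compact (S \<inter> sphere 0 1)" by (simp add: closed_Int_compact)
  have cont: "continuous_on (S \<inter> sphere 0 1) (\<lambda>x. x \<bullet> (A *v x))"
    by (intro continuous_intros linear_continuous_on matrix_vector_mul_bounded_linear)
  obtain x where x: "x \<in> S" "norm x = 1"
    and max: "\<And>z. z \<in> S \<Longrightarrow> norm z = 1 \<Longrightarrow> z \<bullet> (A *v z) \<le> x \<bullet> (A *v x)"
    using continuous_attains_sup[OF comp ne cont] by (auto simp: dist_norm)
  define c where "c = x \<bullet> (A *v x)"
  have max': "z \<bullet> (A *v z) \<le> c * (z \<bullet> z)" if "z \<in> S" for z
  proof (cases "z = 0")
    case False
    have "z /\<^sub>R norm z \<in> S" using that by (auto simp: S_def)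
    from max[OF this] False have "(z \<bullet> (A *v z)) / (norm z)\<^sup>2 \<le> c"
      by (simp add: c_def matrix_vector_mult_scaleR power2_eq_square field_simps)
    then show ?thesis using False
      by (simp add: divide_le_eq power2_norm_eq_inner)
  qed simp
  define w where "w = A *v x - c *\<^sub>R x"
  have "x \<bullet> x = 1" using x by (simp add: norm_eq_1)
  have "w \<in> S"
    unfolding S_def
  proof safe
    fix i assume "i < k"
    then have "e i \<bullet> x = 0" using x by (simp add: S_def)
    then show "e i \<bullet> w = 0"
      using eig \<open>i < k\<close> by (simp add: w_def inner_diff_right adj)
  qed
  have wx: "w \<bullet> x = 0" "x \<bullet> w = 0"
    using \<open>x \<bullet> x = 1\<close> by (simp_all add: w_def c_def inner_diff_left inner_diff_right inner_commute)
  have wA: "w \<bullet> (A *v x) = w \<bullet> w"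
    using wx by (simp add: w_def inner_diff_right inner_commute[of w x])
  (* First-order condition at the maximiser x: moving by t along w gains 2 t |w|^2 and costs O(t^2). *)
  have key: "2 * t * (w \<bullet> w) \<le> t\<^sup>2 * (c * (w \<bullet> w) - w \<bullet> (A *v w))" for t
  proof -
    have "x + t *\<^sub>R w \<in> S" using x \<open>w \<in> S\<close> by (auto simp: S_def inner_add_right)
    from max'[OF this] show ?thesis
      using wx wA \<open>x \<bullet> x = 1\<close> adj[of x w]
      by (simp add: inner_add_left inner_add_right matrix_vector_right_distrib
          matrix_vector_mult_scaleR c_def[symmetric] inner_commute[of "A *v x" w]
          power2_eq_square algebra_simps)
  qed
  have "w \<bullet> w = 0"
  proof (rule ccontr)
    assume "w \<bullet> w \<noteq> 0"
    then have pos: "0 < w \<bullet> w" by simp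
    define b where "b = c * (w \<bullet> w) - w \<bullet> (A *v w)"
    define t where "t = (w \<bullet> w) / (\<bar>b\<bar> + 1)"
    have "0 < t" using pos by (simp add: t_def)
    have "t * b \<le> t * (\<bar>b\<bar> + 1)" using \<open>0 < t\<close> by (intro mult_left_mono) auto
    also have "\<dots> = w \<bullet> w" by (simp add: t_def)
    finally have "t * b < 2 * (w \<bullet> w)" using pos by linarith
    then have "t * (t * b) < t * (2 * (w \<bullet> w))" using \<open>0 < t\<close> by simp
    then show False using key[of t] by (simp add: b_def power2_eq_square mult_ac)
  qed
  then have "A *v x = c *\<^sub>R x" by (simp add: w_def)
  with x show thesis by (intro that[of x c]) (auto simp: S_def)
qed

text \<open>Besides the spectral theorem (from the empty family), this yields the completion of an orthonormal
family to an orthonormal basis, by taking \<open>A\<close> to be the identity.\<close>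

lemma extend_orthonormal_eigenvectors:
  fixes A :: "real^'n^'n"
  assumes sym: "transpose A = A" and on: "orthonormal_family k e"
    and eig: "\<forall>i<k. A *v e i = l i *\<^sub>R e i"
  obtains e' l' where "orthonormal_family CARD('n) e'" "\<forall>i<k. e' i = e i"
    "\<forall>i<CARD('n). A *v e' i = l' i *\<^sub>R e' i"
proof -
  have "\<exists>e' l'. orthonormal_family CARD('n) e' \<and> (\<forall>i<k. e' i = e i) \<and>
      (\<forall>i<CARD('n). A *v e' i = l' i *\<^sub>R e' i)"
    using on eig
  proof (induction "CARD('n) - k" arbitrary: k e l)
    case 0
    then have "k = CARD('n)" using orthonormal_family_le[of k e] by simp
    then show ?case using 0 by blast
  next
    case (Suc d)
    then have "k < CARD('n)" by simp
    from eigenvector_orthogonal_to[OF sym Suc.prems this]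
    obtain x c where x: "norm x = 1" "\<forall>i<k. e i \<bullet> x = 0" "A *v x = c *\<^sub>R x" by blast
    have "orthonormal_family (Suc k) (e(k := x))"
      using Suc.prems(1) x
      by (auto simp: orthonormal_family_def less_Suc_eq norm_eq_1 inner_commute)
    moreover have "\<forall>i<Suc k. A *v (e(k := x)) i = (l(k := c)) i *\<^sub>R (e(k := x)) i"
      using Suc.prems(2) x by (auto simp: less_Suc_eq)
    moreover have "d = CARD('n) - Suc k" using Suc.hyps(2) by simp
    ultimately obtain e' l' where "orthonormal_family CARD('n) e'" 
      "\<forall>i<Suc k. e' i = (e(k := x)) i" "\<forall>i<CARD('n). A *v e' i = l' i *\<^sub>R e' i"
      using Suc.hyps(1)[of "Suc k" "e(k := x)" "l(k := c)"] by blast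
    then show ?case by (intro exI[of _ e'] exI[of _ l']) auto
  qed
  then show thesis using that by blast
qed

lemma orthonormal_family_complete:
  fixes e :: "nat \<Rightarrow> real^'n"
  assumes on: "orthonormal_family CARD('n) e"
  shows "(\<Sum>i<CARD('n). outer (e i) (e i)) = mat 1"
proof -
  obtain b where b: "bij_betw b (UNIV :: 'n set) {..<CARD('n)}"
    using finite_same_card_bij[of "UNIV :: 'n set" "{..<CARD('n)}"] by auto
  then have lt: "b j < CARD('n)" for j by (auto dest: bij_betwE)
  have inj: "b i = b j \<longleftrightarrow> i = j" for i j
    using b by (auto simp: bij_betw_def inj_on_def)
  define E where "E = (\<chi> j. e (b j))"
  have "E ** transpose E = mat 1"
    using orthonormal_familyD[OF on lt lt]
    by (simp add: vec_eq_iff E_def matrix_matrix_mult_def transpose_def mat_def inner_vec_def inj)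
  then have "transpose E ** E = mat 1" by (simp add: matrix_left_right_inverse)
  moreover have "transpose E ** E = (\<Sum>j\<in>UNIV. outer (e (b j)) (e (b j)))"
    by (simp add: vec_eq_iff matrix_matrix_mult_def transpose_def E_def outer_def)
  moreover have "(\<Sum>j\<in>UNIV. outer (e (b j)) (e (b j))) = (\<Sum>i<CARD('n). outer (e i) (e i))"
    by (rule sum.reindex_bij_betw[OF b])
  ultimately show ?thesis by simp
qed

lemma spectral_theorem:
  fixes A :: "real^'n^'n"
  assumes sym: "transpose A = A"
  obtains e l where "orthonormal_family CARD('n) e" "\<forall>i<CARD('n). A *v e i = l i *\<^sub>R e i"
    "A = (\<Sum>i<CARD('n). l i *\<^sub>R outer (e i) (e i))"
proof -
  obtain e l where e: "orthonormal_family CARD('n) e" "\<forall>i<CARD('n). A *v e i = l i *\<^sub>R e i"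
    using extend_orthonormal_eigenvectors[OF sym, of 0 undefined undefined]
    by (auto simp: orthonormal_family_def)
  have "A = A ** (\<Sum>i<CARD('n). outer (e i) (e i))"
    by (simp add: orthonormal_family_complete[OF e(1)])
  also have "\<dots> = (\<Sum>i<CARD('n). l i *\<^sub>R outer (e i) (e i))"
    using e(2) by (simp add: matrix_mult_sum_right matrix_mult_outer outer_scaleR_left)
  finally show thesis using that e by blast
qed

definition thin_svd :: "real^'n^'m \<Rightarrow> nat \<Rightarrow> (nat \<Rightarrow> real) \<Rightarrow> (nat \<Rightarrow> real^'m) \<Rightarrow> (nat \<Rightarrow> real^'n) \<Rightarrow> bool"
  where "thin_svd A r s u v \<longleftrightarrow> (\<forall>i<r. 0 < s i) \<and> orthonormal_family r u \<and> orthonormal_family r v \<and>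
    A = (\<Sum>i<r. s i *\<^sub>R outer (u i) (v i))"

lemma ginv_thin_svd:
  "ginv A = (THE X. \<exists>r s u v. thin_svd A r s u v \<and> X = (\<Sum>i<r. inverse (s i) *\<^sub>R outer (v i) (u i)))"
  unfolding ginv_def thin_svd_def orthonormal_family_def by (simp add: conj_assoc)

text \<open>Take an orthonormal eigenbasis of \<open>A\<^sup>T A\<close>, keep the eigenvectors \<open>v\<close> with positive eigenvalue, and
put \<open>s = sqrt \<lambda>\<close>, \<open>u = A v / s\<close>. The discarded eigenvectors are in the kernel of \<open>A\<close>.\<close>

lemma thin_svd_exists:
  fixes A :: "real^'n^'m"
  obtains r s u v where "thin_svd A r s u v"
proof -
  have "transpose (transpose A ** A) = transpose A ** A" by (simp add: matrix_transpose_mul)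
  from spectral_theorem[OF this] obtain e l where on: "orthonormal_family CARD('n) e"
    and eig: "\<forall>i<CARD('n). (transpose A ** A) *v e i = l i *\<^sub>R e i"
    by blast
  have AA: "(A *v e i) \<bullet> (A *v e j) = l i * (e i \<bullet> e j)" if "i < CARD('n)" for i j
  proof -
    have "(A *v e i) \<bullet> (A *v e j) = (transpose A *v (A *v e i)) \<bullet> e j"
      by (rule inner_mult_vec)
    also have "\<dots> = l i * (e i \<bullet> e j)"
      using eig that by (simp add: matrix_vector_mul_assoc del: transpose_matrix_vector)
    finally show ?thesis .
  qed
  define I where "I = {i. i < CARD('n) \<and> 0 < l i}"
  have "finite I" by (simp add: I_def)
  then obtain b where b: "bij_betw b {..<card I} I"
    using ex_bij_betw_nat_finite[of I] by (auto simp: atLeast0LessThan)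
  then have bI: "b i \<in> I" if "i < card I" for i using that by (auto dest: bij_betwE)
  have inj: "b i = b j \<longleftrightarrow> i = j" if "i < card I" "j < card I" for i j
    using b that by (auto simp: bij_betw_def inj_on_def)
  define v where "v i = e (b i)" for i
  define s where "s i = sqrt (l (b i))" for i
  define u where "u i = (A *v v i) /\<^sub>R s i" for i
  have s: "0 < s i" if "i < card I" for i using bI[OF that] by (simp add: s_def I_def)
  have v: "orthonormal_family (card I) v"
    using on bI inj by (auto simp: orthonormal_family_def v_def I_def)
  have "orthonormal_family (card I) u"
    unfolding orthonormal_family_def
  proof (intro allI impI)
    fix i j assume ij: "i < card I" "j < card I"
    have "u i \<bullet> u j = l (b i) * (v i \<bullet> v j) / (s i * s j)"
      using AA[of "b i" "b j"] bI[OF ij(1)] by (simp add: u_def v_def I_def field_simps)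
    also have "\<dots> = (if i = j then 1 else 0)"
      using orthonormal_familyD[OF v ij] s[OF ij(1)] bI[OF ij(1)]
      by (auto simp: s_def I_def real_sqrt_mult_self)
    finally show "u i \<bullet> u j = (if i = j then 1 else 0)" .
  qed
  moreover have "A = (\<Sum>i<card I. s i *\<^sub>R outer (u i) (v i))"
  proof -
    have zero: "A *v e i = 0" if "i < CARD('n)" "i \<notin> I" for i
    proof -
      have "(A *v e i) \<bullet> (A *v e i) \<le> 0"
        using AA[of i i] that orthonormal_familyD[OF on, of i i] by (auto simp: I_def)
      then show ?thesis using inner_ge_zero[of "A *v e i"] by (metis antisym inner_eq_zero_iff)
    qed
    have "A = A ** (\<Sum>i<CARD('n). outer (e i) (e i))"
      by (simp add: orthonormal_family_complete[OF on])
    also have "\<dots> = (\<Sum>i<CARD('n). outer (A *v e i) (e i))"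
      by (simp add: matrix_mult_sum_right matrix_mult_outer)
    also have "\<dots> = (\<Sum>i\<in>I. outer (A *v e i) (e i))"
      using zero by (intro sum.mono_neutral_right) (auto simp: I_def outer_def vec_eq_iff)
    also have "\<dots> = (\<Sum>i<card I. outer (A *v v i) (v i))"
      using sum.reindex_bij_betw[OF b, of "\<lambda>i. outer (A *v e i) (e i)"] by (simp add: v_def)
    also have "\<dots> = (\<Sum>i<card I. s i *\<^sub>R outer (u i) (v i))"
    proof (rule sum.cong)
      fix i assume "i \<in> {..<card I}"
      then have "s i *\<^sub>R u i = A *v v i" using s[of i] by (simp add: u_def)
      then show "outer (A *v v i) (v i) = s i *\<^sub>R outer (u i) (v i)"
        by (simp flip: outer_scaleR_left)
    qed simp
    finally show ?thesis .
  qed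
  ultimately have "thin_svd A (card I) s u v" unfolding thin_svd_def using s v by blast
  then show thesis by (rule that)
qed

lemma matrix_inv:
  fixes A :: "real^'n^'m"
  assumes "invertible A"
  shows matrix_inv_right: "A ** matrix_inv A = mat 1"
    and matrix_inv_left: "matrix_inv A ** A = mat 1"
proof -
  have "A ** matrix_inv A = mat 1 \<and> matrix_inv A ** A = mat 1"
    unfolding matrix_inv_def by (rule someI_ex) (use assms in \<open>simp add: invertible_def\<close>)
  then show "A ** matrix_inv A = mat 1" "matrix_inv A ** A = mat 1" by auto
qed

lemma matrix_inv_unique:
  fixes A :: "real^'n^'n"
  assumes "B ** A = mat 1"
  shows "matrix_inv A = B" "invertible A"
proof -
  show inv: "invertible A" using assms by (auto simp: invertible_left_inverse)
  have "matrix_inv A = (B ** A) ** matrix_inv A" using assms by simp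
  also have "\<dots> = B" using matrix_inv_right[OF inv] by (simp add: matrix_mul_assoc[symmetric])
  finally show "matrix_inv A = B" .
qed

lemma pos_def_imp_invertible:
  fixes A :: "real^'n^'n"
  assumes "pos_def A"
  shows "invertible A"
proof -
  have "x = 0" if "A *v x = 0" for x
    using assms that by (auto simp: pos_def_def)
  then show ?thesis by (auto simp: invertible_left_inverse matrix_left_invertible_ker)
qed

text \<open>The regularised inverse equals \<open>\<Sum>\<^sub>i s\<^sub>i / (s\<^sub>i\<^sup>2 + d) v\<^sub>i u\<^sub>i\<^sup>T\<close> for every decomposition of \<open>A\<close>, while the
left-hand side does not mention the decomposition. Letting \<open>d\<close> tend to zero therefore shows at once
that the generalized inverse is well defined and that it is a pointwise limit of simpler functions,
from which its measurability follows.\<close>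

lemma thin_svd_ginv_limit:
  fixes A :: "real^'n^'m"
  assumes svd: "thin_svd A r s u v"
  shows "(\<lambda>k. matrix_inv (transpose A ** A + inverse (real (Suc k)) *\<^sub>R mat 1) ** transpose A)
    \<longlonglongrightarrow> (\<Sum>i<r. inverse (s i) *\<^sub>R outer (v i) (u i))"
proof -
  have s: "\<And>i. i < r \<Longrightarrow> 0 < s i" and u: "orthonormal_family r u" and v: "orthonormal_family r v"
    and A: "A = (\<Sum>i<r. s i *\<^sub>R outer (u i) (v i))"
    using svd by (auto simp: thin_svd_def)
  have Av: "A *v v j = s j *\<^sub>R u j" if "j < r" for j
  proof -
    have "A *v v j = (\<Sum>i<r. if i = j then s j *\<^sub>R u j else 0)"
      unfolding arg_cong[OF A, of "\<lambda>A. A *v v j"] sum_mult_vec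
      by (intro sum.cong) (auto simp: scaleR_mult_vec outer_mult_vec orthonormal_familyD[OF v _ that])
    then show ?thesis using that by simp
  qed
  have At: "transpose A = (\<Sum>i<r. s i *\<^sub>R outer (v i) (u i))"
    by (subst A) (simp add: transpose_sum transpose_scalar transpose_outer)
  have Au: "transpose A *v u j = s j *\<^sub>R v j" if "j < r" for j
  proof -
    have "transpose A *v u j = (\<Sum>i<r. if i = j then s j *\<^sub>R v j else 0)"
      unfolding At sum_mult_vec
      by (intro sum.cong) (auto simp: scaleR_mult_vec outer_mult_vec orthonormal_familyD[OF u _ that])
    then show ?thesis using that by simp
  qed
  have eq: "matrix_inv (transpose A ** A + d *\<^sub>R mat 1) ** transpose A
      = (\<Sum>i<r. (s i / ((s i)\<^sup>2 + d)) *\<^sub>R outer (v i) (u i))" if "0 < d" for d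
  proof -
    define N where "N = transpose A ** A + d *\<^sub>R mat 1"
    have Nv: "N *v v j = ((s j)\<^sup>2 + d) *\<^sub>R v j" if "j < r" for j
      using Av[OF that] Au[OF that]
      by (simp add: N_def matrix_vector_mult_add_rdistrib scaleR_mult_vec algebra_simps
          matrix_vector_mul_assoc[symmetric] matrix_vector_mult_scaleR power2_eq_square
          del: transpose_matrix_vector)
    have "pos_def N"
      unfolding pos_def_def
    proof safe
      show "transpose N = N"
        by (simp add: N_def vec_eq_iff transpose_def mat_def matrix_matrix_mult_def mult_ac)
      fix x :: "real^'n" assume "x \<noteq> 0"
      have "x \<bullet> (transpose A *v (A *v x)) = (A *v x) \<bullet> (A *v x)"
        using inner_mult_vec[of x "transpose A" "A *v x"] by simp
      then have "x \<bullet> (N *v x) = (A *v x) \<bullet> (A *v x) + d * (x \<bullet> x)"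
        by (simp add: N_def matrix_vector_mult_add_rdistrib scaleR_mult_vec inner_add_right
          matrix_vector_mul_assoc[symmetric] del: transpose_matrix_vector)
      moreover have "0 < d * (x \<bullet> x)" using \<open>0 < d\<close> \<open>x \<noteq> 0\<close> by simp
      ultimately show "0 < x \<bullet> (N *v x)" by (simp add: add_nonneg_pos)
    qed
    then have inv: "invertible N" by (rule pos_def_imp_invertible)
    have "N ** (\<Sum>i<r. (s i / ((s i)\<^sup>2 + d)) *\<^sub>R outer (v i) (u i)) = transpose A"
      unfolding At matrix_mult_sum_right
    proof (intro sum.cong refl)
      fix i assume "i \<in> {..<r}"
      then have "i < r" by simp
      have "(s i)\<^sup>2 + d \<noteq> 0" using \<open>0 < d\<close> by (smt (verit) zero_le_power2)
      then show "N ** (s i / ((s i)\<^sup>2 + d)) *\<^sub>R outer (v i) (u i) = s i *\<^sub>R outer (v i) (u i)"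
        using Nv[OF \<open>i < r\<close>]
        by (simp add: matrix_scalar_ac matrix_mult_outer scaleR_mult_vec outer_scaleR_left)
    qed
    then have "matrix_inv N ** transpose A
        = (matrix_inv N ** N) ** (\<Sum>i<r. (s i / ((s i)\<^sup>2 + d)) *\<^sub>R outer (v i) (u i))"
      by (simp add: matrix_mul_assoc[symmetric])
    then show ?thesis unfolding matrix_inv_left[OF inv] by (simp add: N_def)
  qed
  have "(\<lambda>k. \<Sum>i<r. (s i / ((s i)\<^sup>2 + inverse (real (Suc k)))) *\<^sub>R outer (v i) (u i))
    \<longlonglongrightarrow> (\<Sum>i<r. (s i / ((s i)\<^sup>2 + 0)) *\<^sub>R outer (v i) (u i))"
    using s by (intro tendsto_intros LIMSEQ_inverse_real_of_nat) fastforce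
  moreover have "(\<Sum>i<r. (s i / ((s i)\<^sup>2 + 0)) *\<^sub>R outer (v i) (u i))
      = (\<Sum>i<r. inverse (s i) *\<^sub>R outer (v i) (u i))"
    using s by (intro sum.cong) (auto simp: power2_eq_square field_simps)
  ultimately show ?thesis by (simp add: eq)
qed

lemma ginv_eq:
  assumes "thin_svd A r s u v"
  shows "ginv A = (\<Sum>i<r. inverse (s i) *\<^sub>R outer (v i) (u i))"
  unfolding ginv_thin_svd
proof (rule the_equality)
  show "\<exists>r0 s' u' v'. thin_svd A r0 s' u' v' \<and>
    (\<Sum>i<r. inverse (s i) *\<^sub>R outer (v i) (u i)) = (\<Sum>i<r0. inverse (s' i) *\<^sub>R outer (v' i) (u' i))"
    using assms by blast
next
  fix X assume "\<exists>r s u v. thin_svd A r s u v \<and> X = (\<Sum>i<r. inverse (s i) *\<^sub>R outer (v i) (u i))"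
  then show "X = (\<Sum>i<r. inverse (s i) *\<^sub>R outer (v i) (u i))"
    using LIMSEQ_unique[OF thin_svd_ginv_limit thin_svd_ginv_limit[OF assms]] by auto
qed

lemma ginv_limit:
  "(\<lambda>k. matrix_inv (transpose A ** A + inverse (real (Suc k)) *\<^sub>R mat 1) ** transpose A)
    \<longlonglongrightarrow> ginv A" for A :: "real^'n^'m"
proof -
  obtain r s u v where svd: "thin_svd A r s u v" by (rule thin_svd_exists)
  from thin_svd_ginv_limit[OF svd] show ?thesis unfolding ginv_eq[OF svd] .
qed

text \<open>Every decomposition gives \<open>A A\<^sup>+ A = A\<close>, and an invertible \<open>A\<close> can be cancelled on the right.\<close>

lemma ginv_eq_matrix_inv:
  fixes A :: "real^'n^'n"
  assumes inv: "invertible A"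
  shows "ginv A = matrix_inv A"
proof -
  obtain r s u v where svd: "thin_svd A r s u v" by (rule thin_svd_exists)
  then have s: "\<And>i. i < r \<Longrightarrow> 0 < s i" and u: "orthonormal_family r u" and v: "orthonormal_family r v"
    and A: "A = (\<Sum>i<r. s i *\<^sub>R outer (u i) (v i))"
    by (auto simp: thin_svd_def)
  define X where "X = ginv A"
  have X: "X = (\<Sum>i<r. inverse (s i) *\<^sub>R outer (v i) (u i))"
    unfolding X_def by (rule ginv_eq[OF svd])
  have Xu: "X *v u j = inverse (s j) *\<^sub>R v j" if "j < r" for j
  proof -
    have "X *v u j = (\<Sum>i<r. if i = j then inverse (s j) *\<^sub>R v j else 0)"
      unfolding X sum_mult_vec
      by (intro sum.cong) (auto simp: scaleR_mult_vec outer_mult_vec orthonormal_familyD[OF u _ that])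
    then show ?thesis using that by simp
  qed
  have Av: "A *v v j = s j *\<^sub>R u j" if "j < r" for j
  proof -
    have "A *v v j = (\<Sum>i<r. if i = j then s j *\<^sub>R u j else 0)"
      unfolding arg_cong[OF A, of "\<lambda>A. A *v v j"] sum_mult_vec
      by (intro sum.cong) (auto simp: scaleR_mult_vec outer_mult_vec orthonormal_familyD[OF v _ that])
    then show ?thesis using that by simp
  qed
  have "(A ** X) ** A = (\<Sum>i<r. (A ** X) ** (s i *\<^sub>R outer (u i) (v i)))"
    by (subst (2) A) (rule matrix_mult_sum_right)
  also have "\<dots> = (\<Sum>i<r. s i *\<^sub>R outer (u i) (v i))"
  proof (intro sum.cong refl)
    fix i assume "i \<in> {..<r}"
    then have "(A ** X) *v u i = u i"
      using Xu[of i] Av[of i] s[of i]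
      by (simp add: matrix_vector_mul_assoc[symmetric] matrix_vector_mult_scaleR)
    then show "(A ** X) ** (s i *\<^sub>R outer (u i) (v i)) = s i *\<^sub>R outer (u i) (v i)"
      by (simp add: matrix_scalar_ac matrix_mult_outer scaleR_mult_vec outer_scaleR_left)
  qed
  also have "\<dots> = A" by (simp only: A[symmetric])
  finally have "(A ** X) ** A ** matrix_inv A = A ** matrix_inv A" by simp
  then have "A ** X = mat 1"
    using matrix_inv_right[OF inv] by (simp add: matrix_mul_assoc[symmetric])
  then have "X ** A = mat 1" by (simp add: matrix_left_right_inverse)
  from matrix_inv_unique(1)[OF this] show ?thesis by (simp add: X_def)
qed

section \<open>Continuity and measurability of matrix operations\<close>

text \<open>In finite dimension bilinear operations are automatically continuous. One such fact per operation
supplies both its limit rule and its measurability rule.\<close>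

lemma bounded_bilinear_matrix_mult:
  "bounded_bilinear ((**) :: real^'n^'m \<Rightarrow> real^'p^'n \<Rightarrow> real^'p^'m)"
  unfolding bilinear_conv_bounded_bilinear[symmetric] bilinear_def linear_iff
  by (auto simp: matrix_matrix_mult_def vec_eq_iff sum.distrib sum_distrib_left algebra_simps)

lemma bounded_bilinear_matrix_vector_mult:
  "bounded_bilinear ((*v) :: real^'n^'m \<Rightarrow> real^'n \<Rightarrow> real^'m)"
  unfolding bilinear_conv_bounded_bilinear[symmetric] bilinear_def linear_iff
  by (auto simp: matrix_vector_mult_add_rdistrib matrix_vector_right_distrib
      matrix_vector_mult_scaleR scaleR_mult_vec)

lemma bounded_bilinear_kron:
  "bounded_bilinear (kron :: real^'b^'a \<Rightarrow> real^'d^'c \<Rightarrow> real^('b \<times> 'd)^('a \<times> 'c))"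
  unfolding bilinear_conv_bounded_bilinear[symmetric] bilinear_def linear_iff
  by (auto simp: kron_def vec_eq_iff algebra_simps)

lemma bounded_bilinear_hadamard:
  "bounded_bilinear (hadamard :: real^'n^'m \<Rightarrow> real^'n^'m \<Rightarrow> real^'n^'m)"
  unfolding bilinear_conv_bounded_bilinear[symmetric] bilinear_def linear_iff
  by (auto simp: hadamard_def vec_eq_iff algebra_simps)

lemma bounded_bilinear_outer:
  "bounded_bilinear (outer :: real^'m \<Rightarrow> real^'n \<Rightarrow> real^'n^'m)"
  unfolding bilinear_conv_bounded_bilinear[symmetric] bilinear_def linear_iff
  by (auto simp: outer_def vec_eq_iff algebra_simps)

lemma bounded_linear_transpose: "bounded_linear (transpose :: real^'n^'m \<Rightarrow> real^'m^'n)"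
  unfolding linear_conv_bounded_linear[symmetric] linear_iff
  by (auto simp: transpose_def vec_eq_iff)

lemma bounded_linear_vec_of: "bounded_linear (vec_of :: real^'n^'m \<Rightarrow> real^('n \<times> 'm))"
  unfolding linear_conv_bounded_linear[symmetric] linear_iff
  by (auto simp: vec_of_def vec_eq_iff)

lemma bounded_linear_diag: "bounded_linear (diag :: real^'n \<Rightarrow> real^'n^'n)"
  unfolding linear_conv_bounded_linear[symmetric] linear_iff
  by (auto simp: diag_def vec_eq_iff)

lemmas tendsto_matrix_ops [tendsto_intros] =
  bounded_bilinear.tendsto[OF bounded_bilinear_matrix_mult]
  bounded_bilinear.tendsto[OF bounded_bilinear_matrix_vector_mult]
  bounded_bilinear.tendsto[OF bounded_bilinear_kron]
  bounded_bilinear.tendsto[OF bounded_bilinear_hadamard]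
  bounded_bilinear.tendsto[OF bounded_bilinear_outer]
  bounded_linear.tendsto[OF bounded_linear_transpose]
  bounded_linear.tendsto[OF bounded_linear_vec_of]
  bounded_linear.tendsto[OF bounded_linear_diag]

lemma borel_measurable_bounded_bilinear:
  fixes h :: "'a::euclidean_space \<Rightarrow> 'b::euclidean_space \<Rightarrow> 'c::euclidean_space"
  assumes h: "bounded_bilinear h" and f: "f \<in> borel_measurable N" and g: "g \<in> borel_measurable N"
  shows "(\<lambda>x. h (f x) (g x)) \<in> borel_measurable N"
  using f g
proof (rule borel_measurable_continuous_Pair)
  show "continuous_on UNIV (\<lambda>x. h (fst x) (snd x))"
    by (intro bounded_bilinear.continuous_on[OF h] continuous_intros)
qed

lemmas borel_measurable_matrix_ops [measurable (raw)] =
  borel_measurable_bounded_bilinear[OF bounded_bilinear_matrix_mult]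
  borel_measurable_bounded_bilinear[OF bounded_bilinear_matrix_vector_mult]
  borel_measurable_bounded_bilinear[OF bounded_bilinear_kron]
  borel_measurable_bounded_bilinear[OF bounded_bilinear_hadamard]
  borel_measurable_bounded_bilinear[OF bounded_bilinear_outer]

lemma borel_measurable_vecI:
  fixes f :: "'w \<Rightarrow> 'a::euclidean_space^'n"
  assumes "\<And>i. (\<lambda>x. f x $ i) \<in> borel_measurable N"
  shows "f \<in> borel_measurable N"
  unfolding borel_measurable_euclidean_space[of f]
  using assms by (auto simp: Basis_vec_def inner_axis)

lemma borel_measurable_bounded_linear:
  fixes h :: "'a::euclidean_space \<Rightarrow> 'b::euclidean_space"
  assumes "bounded_linear h" "f \<in> borel_measurable N"
  shows "(\<lambda>x. h (f x)) \<in> borel_measurable N"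
  using borel_measurable_continuous_on[OF linear_continuous_on[OF assms(1)] assms(2)] .

lemmas borel_measurable_linear_matrix_ops [measurable (raw)] =
  borel_measurable_bounded_linear[OF bounded_linear_transpose]
  borel_measurable_bounded_linear[OF bounded_linear_vec_of]
  borel_measurable_bounded_linear[OF bounded_linear_diag]
  borel_measurable_bounded_linear[OF bounded_linear_vec_nth]

lemma tendsto_det [tendsto_intros]:
  fixes f :: "'w \<Rightarrow> real^'n^'n"
  assumes "(f \<longlongrightarrow> A) F"
  shows "((\<lambda>x. det (f x)) \<longlongrightarrow> det A) F"
  unfolding det_def by (intro tendsto_intros assms)

text \<open>An explicit rational expression for the inverse, from which continuity can be read off.\<close>

definition cramer_inverse :: "real^'n^'n \<Rightarrow> real^'n^'n" where
  "cramer_inverse A = (\<chi> k j. det (\<chi> i j'. if j' = k then axis j 1 $ i else A $ i $ j') / det A)"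

lemma matrix_inv_cramer:
  assumes "invertible A"
  shows "matrix_inv A = cramer_inverse A"
proof -
  have "matrix_inv A $ k $ j = cramer_inverse A $ k $ j" for k j
  proof -
    have "A *v (matrix_inv A *v axis j 1) = axis j 1"
      by (simp add: matrix_vector_mul_assoc matrix_inv_right[OF assms])
    then have "(matrix_inv A *v axis j 1) $ k =
        det (\<chi> i j'. if j' = k then axis j 1 $ i else A $ i $ j') / det A"
      using assms by (subst (asm) cramer) (auto simp: invertible_det_nz)
    then show ?thesis by (simp add: cramer_inverse_def matrix_vector_mult_basis column_def)
  qed
  then show ?thesis by (simp add: vec_eq_iff)
qed

lemma tendsto_cramer_inverse:
  fixes f :: "'w \<Rightarrow> real^'n^'n"
  assumes f: "(f \<longlongrightarrow> A) F" and "det A \<noteq> 0"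
  shows "((\<lambda>x. cramer_inverse (f x)) \<longlongrightarrow> cramer_inverse A) F"
proof -
  have "((\<lambda>x. if j' = k then axis j 1 $ i else f x $ i $ j')
      \<longlongrightarrow> (if j' = k then axis j 1 $ i else A $ i $ j')) F" for i j j' k
    by (cases "j' = k") (auto intro!: tendsto_intros f)
  then show ?thesis
    unfolding cramer_inverse_def by (intro tendsto_intros f assms(2))
qed

lemma tendsto_matrix_inv:
  fixes f :: "'w \<Rightarrow> real^'n^'n"
  assumes f: "(f \<longlongrightarrow> A) F" and inv: "invertible A"
  shows "((\<lambda>x. matrix_inv (f x)) \<longlongrightarrow> matrix_inv A) F" "\<forall>\<^sub>F x in F. invertible (f x)"
proof -
  have d: "det A \<noteq> 0" using inv by (simp add: invertible_det_nz)
  show ev: "\<forall>\<^sub>F x in F. invertible (f x)"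
    using tendsto_imp_eventually_ne[OF tendsto_det[OF f] d] by (simp add: invertible_det_nz)
  have "((\<lambda>x. cramer_inverse (f x)) \<longlongrightarrow> matrix_inv A) F"
    using tendsto_cramer_inverse[OF f d] by (simp add: matrix_inv_cramer[OF inv])
  then show "((\<lambda>x. matrix_inv (f x)) \<longlongrightarrow> matrix_inv A) F"
    by (rule Lim_transform_eventually) (use ev in eventually_elim, simp add: matrix_inv_cramer)
qed

text \<open>Measurability is needed on the whole space, since nothing prevents the sample from producing a
singular matrix. There \<^const>\<open>matrix_inv\<close> is a choice among no candidates, hence one fixed
matrix; elsewhere Cramer's rule makes it continuous.\<close>

lemma borel_measurable_matrix_inv [measurable]:
  "(matrix_inv :: real^'n^'n \<Rightarrow> real^'n^'n) \<in> borel_measurable borel"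
proof -
  let ?c = "SOME X :: real^'n^'n. False"
  have eq: "matrix_inv = (\<lambda>A :: real^'n^'n. if det A \<noteq> 0 then cramer_inverse A else ?c)"
  proof
    fix A :: "real^'n^'n"
    have "matrix_inv A = ?c" if "\<not> invertible A"
      using that unfolding matrix_inv_def invertible_def by (intro arg_cong[of _ _ Eps]) auto
    then show "matrix_inv A = (if det A \<noteq> 0 then cramer_inverse A else ?c)"
      by (simp add: matrix_inv_cramer invertible_det_nz)
  qed
  have cont_det: "continuous_on S (det :: real^'n^'n \<Rightarrow> real)" for S
    unfolding continuous_on_def by (intro ballI tendsto_intros)
  have "continuous_on {A :: real^'n^'n. det A \<noteq> 0} cramer_inverse"
    unfolding continuous_on_def by (auto intro!: tendsto_cramer_inverse tendsto_intros)
  moreover have "{A :: real^'n^'n. det A \<noteq> 0} \<in> sets borel"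
    by (intro borel_open open_Collect_neq cont_det continuous_on_const)
  ultimately show ?thesis
    unfolding eq
    using borel_measurable_continuous_on_if[of "{A. det A \<noteq> 0}" cramer_inverse "\<lambda>_. ?c"] by simp
qed

lemma borel_measurable_ginv [measurable]:
  "(ginv :: real^'n^'m \<Rightarrow> real^'m^'n) \<in> borel_measurable borel"
proof (rule borel_measurable_LIMSEQ_metric)
  fix k
  show "(\<lambda>A :: real^'n^'m. matrix_inv (transpose A ** A + inverse (real (Suc k)) *\<^sub>R mat 1) ** transpose A)
      \<in> borel_measurable borel"
    by measurable
qed (rule ginv_limit)

section \<open>Gaussian measures and projected quadratic forms\<close>

text \<open>Here \<open>L\<close> has the rows \<open>sqrt \<lambda>\<^sub>i e\<^sub>i\<^sup>T\<close> for an orthonormal eigenbasis.\<close>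

lemma pos_def_factor:
  fixes G :: "real^'n^'n"
  assumes "pos_def G"
  obtains L :: "real^'n^'n" where "transpose L ** L = G"
proof -
  obtain e l where on: "orthonormal_family CARD('n) e" and eig: "\<forall>i<CARD('n). G *v e i = l i *\<^sub>R e i"
    and G: "G = (\<Sum>i<CARD('n). l i *\<^sub>R outer (e i) (e i))"
    using spectral_theorem[of G thesis] assms unfolding pos_def_def by blast
  have l: "0 < l i" if "i < CARD('n)" for i
  proof -
    have "e i \<bullet> e i = 1" using orthonormal_familyD[OF on that that] by simp
    moreover from this have "e i \<noteq> 0" by auto
    ultimately show ?thesis using assms eig that by (auto simp: pos_def_def)
  qed
  obtain b where b: "bij_betw b (UNIV :: 'n set) {..<CARD('n)}"
    using finite_same_card_bij[of "UNIV :: 'n set" "{..<CARD('n)}"] by auto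
  then have lt: "b j < CARD('n)" for j by (auto dest: bij_betwE)
  define L where "L = (\<chi> j. sqrt (l (b j)) *\<^sub>R e (b j))"
  have "transpose L ** L = (\<Sum>j\<in>UNIV. l (b j) *\<^sub>R outer (e (b j)) (e (b j)))"
  proof -
    have sq: "sqrt (l (b j)) * x * (sqrt (l (b j)) * y) = l (b j) * (x * y)" for j x y
    proof -
      have "sqrt (l (b j)) * x * (sqrt (l (b j)) * y) = (sqrt (l (b j)) * sqrt (l (b j))) * (x * y)"
        by (simp only: mult_ac)
      then show ?thesis using l[OF lt[of j]] by simp
    qed
    show ?thesis
      by (simp add: vec_eq_iff matrix_matrix_mult_def transpose_def L_def outer_def sq)
  qed
  also have "\<dots> = (\<Sum>i<CARD('n). l i *\<^sub>R outer (e i) (e i))"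
    by (rule sum.reindex_bij_betw[OF b])
  also have "\<dots> = G" by (rule G[symmetric])
  finally show thesis by (rule that)
qed

lemma nn_integral_lborel_translate:
  fixes g :: "'a::euclidean_space \<Rightarrow> ennreal"
  assumes [measurable]: "g \<in> borel_measurable borel"
  shows "(\<integral>\<^sup>+x. g (c + x) \<partial>lborel) = (\<integral>\<^sup>+x. g x \<partial>lborel)"
  by (subst (2) lborel_distr_plus[of c, symmetric]) (simp add: nn_integral_distr)

text \<open>The image of Lebesgue measure under a linear bijection is translation invariant, hence a multiple of
Lebesgue measure. The proof is the classical uniqueness argument for Haar measure: insert a factor
\<open>\<integral> h = 1\<close>, exchange the integrals and translate, until \<open>g\<close> and \<open>h\<close> have traded places. The value of
the constant is immaterial below.\<close>

lemma nn_integral_lborel_linear: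
  fixes f :: "'a::euclidean_space \<Rightarrow> 'a"
  assumes lin: "linear f" and bij: "bij f"
  obtains c where "\<And>g. g \<in> borel_measurable borel \<Longrightarrow>
    (\<integral>\<^sup>+x. g (f x) \<partial>lborel) = c * (\<integral>\<^sup>+x. g x \<partial>lborel)"
proof -
  have f_inv: "f (inv f y) = y" for y using bij by (simp add: bij_is_surj surj_f_inv_f)
  have f_add: "f (x + y) = f x + f y" for x y using lin by (rule linear_add)
  have [measurable]: "f \<in> borel_measurable borel"
    using linear_continuous_on[of f UNIV] lin
    by (simp add: linear_conv_bounded_linear borel_measurable_continuous_onI)
  define h :: "'a \<Rightarrow> ennreal" where "h = indicator (cbox 0 One)"
  have h1: "(\<integral>\<^sup>+y. h y \<partial>lborel) = 1"
    by (simp add: h_def emeasure_lborel_cbox)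
  have [measurable]: "h \<in> borel_measurable borel" by (simp add: h_def)
  define c where "c = (\<integral>\<^sup>+x. h (- f x) \<partial>lborel)"
  show thesis
  proof (rule that)
    fix g :: "'a \<Rightarrow> ennreal" assume [measurable]: "g \<in> borel_measurable borel"
    have "(\<integral>\<^sup>+x. g (f x) \<partial>lborel) = (\<integral>\<^sup>+x. \<integral>\<^sup>+y. g (f x) * h y \<partial>lborel \<partial>lborel)"
      by (simp add: nn_integral_cmult h1)
    also have "\<dots> = (\<integral>\<^sup>+y. \<integral>\<^sup>+x. g (f x) * h y \<partial>lborel \<partial>lborel)"
      by (rule lborel_pair.Fubini') measurable
    also have "\<dots> = (\<integral>\<^sup>+y. \<integral>\<^sup>+x. g (f (inv f y + x)) * h y \<partial>lborel \<partial>lborel)"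
    proof (rule nn_integral_cong)
      fix y :: 'a
      show "(\<integral>\<^sup>+x. g (f x) * h y \<partial>lborel) = (\<integral>\<^sup>+x. g (f (inv f y + x)) * h y \<partial>lborel)"
        using nn_integral_lborel_translate[of "\<lambda>x. g (f x) * h y" "inv f y"] by simp
    qed
    also have "\<dots> = (\<integral>\<^sup>+y. \<integral>\<^sup>+x. g (y + f x) * h y \<partial>lborel \<partial>lborel)"
      by (simp add: f_add f_inv)
    also have "\<dots> = (\<integral>\<^sup>+x. \<integral>\<^sup>+y. g (y + f x) * h y \<partial>lborel \<partial>lborel)"
      by (rule lborel_pair.Fubini'[symmetric]) measurable
    also have "\<dots> = (\<integral>\<^sup>+x. \<integral>\<^sup>+y. g y * h (- f x + y) \<partial>lborel \<partial>lborel)"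
    proof (rule nn_integral_cong)
      fix x :: 'a
      show "(\<integral>\<^sup>+y. g (y + f x) * h y \<partial>lborel) = (\<integral>\<^sup>+y. g y * h (- f x + y) \<partial>lborel)"
        using nn_integral_lborel_translate[of "\<lambda>y. g (y + f x) * h y" "- f x"] by simp
    qed
    also have "\<dots> = (\<integral>\<^sup>+y. \<integral>\<^sup>+x. g y * h (- f x + y) \<partial>lborel \<partial>lborel)"
      by (rule lborel_pair.Fubini') measurable
    also have "\<dots> = (\<integral>\<^sup>+y. g y * c \<partial>lborel)"
    proof (rule nn_integral_cong)
      fix y :: 'a
      have "(\<integral>\<^sup>+x. g y * h (- f x + y) \<partial>lborel) = g y * (\<integral>\<^sup>+x. h (- f x + y) \<partial>lborel)"
        by (rule nn_integral_cmult) measurable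
      also have "(\<integral>\<^sup>+x. h (- f x + y) \<partial>lborel) = c"
        using nn_integral_lborel_translate[of "\<lambda>x. h (- f x + y)" "inv f y"]
        by (simp add: f_add f_inv c_def)
      finally show "(\<integral>\<^sup>+x. g y * h (- f x + y) \<partial>lborel) = g y * c" .
    qed
    also have "\<dots> = (\<integral>\<^sup>+y. g y \<partial>lborel) * c"
      by (rule nn_integral_multc) measurable
    also have "\<dots> = c * (\<integral>\<^sup>+y. g y \<partial>lborel)"
      by (rule mult.commute)
    finally show "(\<integral>\<^sup>+x. g (f x) \<partial>lborel) = c * (\<integral>\<^sup>+x. g x \<partial>lborel)" .
  qed
qed

lemma Basis_real_vec: "(Basis :: (real^'n) set) = (\<lambda>j. axis j 1) ` UNIV"
  by (auto simp: Basis_vec_def)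

lemma inj_axis_one: "inj (\<lambda>j. axis j (1::real))"
  by (auto simp: inj_on_def axis_eq_axis)

lemma nn_integral_lborel_vec_prod:
  fixes f :: "'n::finite \<Rightarrow> real \<Rightarrow> ennreal"
  assumes "\<And>j. f j \<in> borel_measurable borel"
  shows "(\<integral>\<^sup>+x. (\<Prod>j\<in>UNIV. f j (x $ j)) \<partial>(lborel :: (real^'n) measure)) = (\<Prod>j\<in>UNIV. \<integral>\<^sup>+x. f j x \<partial>lborel)"
proof -
  define i :: "real^'n \<Rightarrow> 'n" where "i b = (THE j. b = axis j 1)" for b
  have i: "i (axis j 1) = j" for j by (simp add: i_def axis_eq_axis)
  have "(\<integral>\<^sup>+x. (\<Prod>b\<in>Basis. f (i b) (x \<bullet> b)) \<partial>(lborel :: (real^'n) measure))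
      = (\<Prod>b\<in>Basis. \<integral>\<^sup>+x. f (i b) x \<partial>lborel)"
    by (rule nn_integral_lborel_prod) (auto intro: assms)
  then show ?thesis
    by (simp add: Basis_real_vec prod.reindex[OF inj_axis_one] i inner_axis)
qed

definition std_gaussian :: "(real^'n) measure" where
  "std_gaussian = density lborel (\<lambda>y. \<Prod>j\<in>UNIV. ennreal (std_normal_density (y $ j)))"

lemma sets_std_gaussian [measurable_cong, simp]: "sets std_gaussian = sets borel"
  by (simp add: std_gaussian_def)

lemma space_std_gaussian [simp]: "space std_gaussian = UNIV"
  by (simp add: std_gaussian_def)

lemma emeasure_std_gaussian_box:
  fixes B :: "'n::finite \<Rightarrow> real set"
  assumes B: "\<And>j. B j \<in> sets borel"
  shows "emeasure (std_gaussian :: (real^'n) measure) {y. \<forall>j. y $ j \<in> B j}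
    = (\<Prod>j\<in>UNIV. emeasure (density lborel std_normal_density) (B j))"
proof -
  have [measurable]: "B j \<in> sets borel" for j by (rule B)
  have meas: "{y :: real^'n. \<forall>j. y $ j \<in> B j} \<in> sets borel"
    by measurable
  have ind: "indicator {y :: real^'n. \<forall>j. y $ j \<in> B j} y = (\<Prod>j\<in>UNIV. indicator (B j) (y $ j) :: ennreal)" for y
    by (auto simp: indicator_def prod_zero_iff)
  have "emeasure std_gaussian {y :: real^'n. \<forall>j. y $ j \<in> B j}
      = (\<integral>\<^sup>+y. (\<Prod>j\<in>UNIV. ennreal (std_normal_density (y $ j)) * indicator (B j) (y $ j)) \<partial>lborel)"
    using meas by (simp add: std_gaussian_def emeasure_density ind prod.distrib)
  also have "\<dots> = (\<Prod>j\<in>UNIV. \<integral>\<^sup>+x. ennreal (std_normal_density x) * indicator (B j) x \<partial>lborel)"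
    by (rule nn_integral_lborel_vec_prod) measurable
  also have "\<dots> = (\<Prod>j\<in>UNIV. emeasure (density lborel std_normal_density) (B j))"
    by (simp add: emeasure_density)
  finally show ?thesis .
qed

lemma prob_space_std_normal: "prob_space (density lborel std_normal_density)"
  by (rule prob_space_normal_density) simp

lemma emeasure_std_normal_UNIV: "emeasure (density lborel std_normal_density) UNIV = 1"
  using prob_space.emeasure_space_1[OF prob_space_std_normal] by simp

lemma emeasure_std_gaussian_UNIV: "emeasure (std_gaussian :: (real^'n) measure) UNIV = 1"
  using emeasure_std_gaussian_box[of "\<lambda>_::'n. UNIV"] by (simp add: emeasure_std_normal_UNIV)

lemma std_gaussian_coordinates:
  fixes e :: "nat \<Rightarrow> 'n::finite"
  assumes inj: "inj_on e {..<k}"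
  shows "distr (std_gaussian :: (real^'n) measure) (\<Pi>\<^sub>M i\<in>{..<k}. density lborel std_normal_density)
      (\<lambda>y. \<lambda>i\<in>{..<k}. y $ e i) = (\<Pi>\<^sub>M i\<in>{..<k}. density lborel std_normal_density)"
proof -
  let ?N = "density lborel (\<lambda>x. ennreal (std_normal_density x))"
  interpret N: prob_space ?N by (rule prob_space_std_normal)
  interpret product_prob_space "\<lambda>_. ?N" "{..<k}" ..
  have meas: "(\<lambda>y :: real^'n. \<lambda>i\<in>{..<k}. y $ e i) \<in> borel \<rightarrow>\<^sub>M (\<Pi>\<^sub>M i\<in>{..<k}. ?N)"
    by measurable
  have meas': "(\<lambda>y :: real^'n. \<lambda>i\<in>{..<k}. y $ e i) \<in> std_gaussian \<rightarrow>\<^sub>M (\<Pi>\<^sub>M i\<in>{..<k}. ?N)"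
    using meas by (simp only: measurable_cong_sets[OF sets_std_gaussian refl])
  show ?thesis
  proof (rule PiM_eqI)
    fix A assume A: "\<And>i. i \<in> {..<k} \<Longrightarrow> A i \<in> sets ?N"
    then have box: "Pi\<^sub>E {..<k} A \<in> sets (\<Pi>\<^sub>M i\<in>{..<k}. ?N)"
      by (intro sets_PiM_I_finite) auto
    (* The coordinates outside the range of e are unconstrained and contribute a factor one. *)
    define B where "B j = (if j \<in> e ` {..<k} then A (inv_into {..<k} e j) else UNIV)" for j
    have Be: "B (e i) = A i" if "i < k" for i using that inj by (simp add: B_def)
    have B: "B j \<in> sets borel" for j
      using A inv_into_into[of j e "{..<k}"] by (auto simp: B_def)
    have B_iff: "(\<forall>j. y $ j \<in> B j) \<longleftrightarrow> (\<forall>i<k. y $ e i \<in> A i)" for y :: "real^'n"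
    proof
      assume *: "\<forall>j. y $ j \<in> B j"
      show "\<forall>i<k. y $ e i \<in> A i"
      proof (intro allI impI)
        fix i assume "i < k"
        then show "y $ e i \<in> A i" using *[rule_format, of "e i"] by (simp add: Be)
      qed
    next
      assume *: "\<forall>i<k. y $ e i \<in> A i"
      show "\<forall>j. y $ j \<in> B j"
      proof
        fix j
        show "y $ j \<in> B j"
        proof (cases "j \<in> e ` {..<k}")
          case True
          then obtain i where "i < k" "j = e i" by auto
          then show ?thesis using * by (simp add: Be)
        qed (simp add: B_def)
      qed
    qed
    have "(\<lambda>y. \<lambda>i\<in>{..<k}. y $ e i) -` (Pi\<^sub>E {..<k} A) \<inter> space (std_gaussian :: (real^'n) measure)
        = {y. \<forall>j. y $ j \<in> B j}"
      by (simp add: B_iff vimage_def Pi_iff Ball_def)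
    then have "emeasure (distr (std_gaussian :: (real^'n) measure) (\<Pi>\<^sub>M i\<in>{..<k}. ?N)
        (\<lambda>y. \<lambda>i\<in>{..<k}. y $ e i)) (Pi\<^sub>E {..<k} A) = (\<Prod>j\<in>UNIV. emeasure ?N (B j))"
      by (simp add: emeasure_distr[OF meas' box] emeasure_std_gaussian_box[OF B])
    also have "\<dots> = (\<Prod>j\<in>e ` {..<k}. emeasure ?N (B j))"
      by (intro prod.mono_neutral_right) (auto simp: B_def emeasure_std_normal_UNIV)
    also have "\<dots> = (\<Prod>i\<in>{..<k}. emeasure ?N (A i))"
      using inj by (simp add: prod.reindex Be)
    finally show "emeasure (distr (std_gaussian :: (real^'n) measure) (\<Pi>\<^sub>M i\<in>{..<k}. ?N)
        (\<lambda>y. \<lambda>i\<in>{..<k}. y $ e i)) (Pi\<^sub>E {..<k} A) = (\<Prod>i\<in>{..<k}. emeasure ?N (A i))" .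
  qed simp_all
qed

lemma chi_squared_std_gaussian:
  fixes e :: "nat \<Rightarrow> 'n::finite"
  assumes inj: "inj_on e {..<k}"
  shows "distr (std_gaussian :: (real^'n) measure) borel (\<lambda>y. \<Sum>i<k. (y $ e i)\<^sup>2) = chi_squared k"
proof -
  let ?N = "density lborel (\<lambda>x. ennreal (std_normal_density x))"
  have [measurable]: "(\<lambda>y :: real^'n. \<lambda>i\<in>{..<k}. y $ e i) \<in> borel \<rightarrow>\<^sub>M (\<Pi>\<^sub>M i\<in>{..<k}. ?N)"
    by measurable
  have [measurable]: "(\<lambda>x. \<Sum>i<k. (x i)\<^sup>2) \<in> borel_measurable (\<Pi>\<^sub>M i\<in>{..<k}. ?N)"
    by measurable
  show ?thesis
    unfolding chi_squared_def
    by (subst std_gaussian_coordinates[OF inj, symmetric], subst distr_distr)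
      (simp_all add: comp_def measurable_cong_sets[OF sets_std_gaussian refl])
qed

lemma pos_def_matrix_inv:
  fixes A :: "real^'n^'n"
  assumes A: "pos_def A"
  shows "pos_def (matrix_inv A)"
proof -
  have inv: "invertible A" using A by (rule pos_def_imp_invertible)
  have sym: "transpose A = A" using A by (simp add: pos_def_def)
  have "transpose (A ** matrix_inv A) = mat 1" by (simp add: matrix_inv_right[OF inv])
  then have "transpose (matrix_inv A) ** A = mat 1" by (simp add: matrix_transpose_mul sym)
  then have sym': "transpose (matrix_inv A) = matrix_inv A"
    by (rule matrix_inv_unique(1)[symmetric])
  moreover have "0 < x \<bullet> (matrix_inv A *v x)" if "x \<noteq> 0" for x
  proof -
    define y where "y = matrix_inv A *v x"
    have x: "x = A *v y" by (simp add: y_def matrix_vector_mul_assoc matrix_inv_right[OF inv])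
    then have "y \<noteq> 0" using that by auto
    then have "0 < y \<bullet> (A *v y)"
      using A by (simp add: pos_def_def)
    also have "y \<bullet> (A *v y) = x \<bullet> (matrix_inv A *v x)"
      unfolding y_def[symmetric] by (simp only: x[symmetric] inner_commute)
    finally show ?thesis .
  qed
  ultimately show ?thesis by (simp add: pos_def_def)
qed

lemma pos_def_congruence:
  fixes S :: "real^'n^'n" and C :: "real^'n^'k"
  assumes S: "pos_def S" and inj: "\<And>x. transpose C *v x = 0 \<Longrightarrow> x = 0"
  shows "pos_def (C ** S ** transpose C)"
proof -
  have "0 < x \<bullet> ((C ** S ** transpose C) *v x)" if "x \<noteq> 0" for x
  proof -
    have "x \<bullet> ((C ** S ** transpose C) *v x) = (transpose C *v x) \<bullet> (S *v (transpose C *v x))"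
      by (simp only: matrix_vector_mul_assoc[symmetric] inner_mult_vec[of x C])
    then show ?thesis using S inj[of x] that by (auto simp: pos_def_def simp del: transpose_matrix_vector)
  qed
  moreover have "transpose (C ** S ** transpose C) = C ** S ** transpose C"
    using S by (simp add: matrix_transpose_mul pos_def_def matrix_mul_assoc)
  ultimately show ?thesis by (simp add: pos_def_def)
qed

lemma quadratic_form_factor:
  "x \<bullet> ((transpose L ** L) *v x) = (L *v x) \<bullet> (L *v x)" for L :: "real^'n^'m"
  using inner_mult_vec[of x "transpose L" "L *v x"] by (simp add: matrix_vector_mul_assoc)

text \<open>With \<open>N = C S C\<^sup>T\<close>, factor \<open>N\<^sup>-\<^sup>1 = L\<^sup>T L\<close> and \<open>S\<^sup>-\<^sup>1 = R\<^sup>T R\<close>. The matrix \<open>Z = L C S R\<^sup>T\<close> satisfies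
\<open>Z R = L C\<close> and has orthonormal rows, so its rows extend to an orthogonal matrix \<open>E\<close>, and \<open>Q = E R\<close>
turns the projected form \<open>\<bar>L C x\<bar>\<^sup>2\<close> into a sum of squares of some of the coordinates of \<open>Q x\<close>.
The factor \<open>S R\<^sup>T\<close> stands for \<open>R\<^sup>-\<^sup>1\<close>.\<close>

lemma whitening_transformation:
  fixes S :: "real^'n^'n" and C :: "real^'n^'k"
  assumes S: "pos_def S" and CSC: "pos_def (C ** S ** transpose C)"
  obtains Q :: "real^'n^'n" and e :: "nat \<Rightarrow> 'n"
  where "transpose Q ** Q = matrix_inv S" "inj_on e {..<CARD('k)}"
    "\<And>x. (C *v x) \<bullet> (matrix_inv (C ** S ** transpose C) *v (C *v x)) = (\<Sum>i<CARD('k). ((Q *v x) $ e i)\<^sup>2)"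
proof -
  define N where "N = C ** S ** transpose C"
  have "invertible S" "invertible N"
    using S CSC by (auto simp: N_def intro: pos_def_imp_invertible)
  have symS: "transpose S = S" using S by (simp add: pos_def_def)
  obtain L :: "real^'k^'k" where L: "transpose L ** L = matrix_inv N"
    unfolding N_def by (rule pos_def_factor[OF pos_def_matrix_inv[OF CSC]])
  obtain R :: "real^'n^'n" where R: "transpose R ** R = matrix_inv S"
    by (rule pos_def_factor[OF pos_def_matrix_inv[OF S]])
  have SRR: "S ** transpose R ** R = mat 1"
    by (simp add: matrix_mul_assoc[symmetric] R matrix_inv_right[OF \<open>invertible S\<close>])
  have "transpose L ** (L ** N) = mat 1"
    by (simp add: matrix_mul_assoc L matrix_inv_left[OF \<open>invertible N\<close>])
  then have LNL: "(L ** N) ** transpose L = mat 1" by (simp add: matrix_left_right_inverse)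
  define Z where "Z = L ** C ** S ** transpose R"
  have ZR: "Z ** R = L ** C"
    using SRR by (simp add: Z_def matrix_mul_assoc[symmetric])
  have "Z ** transpose Z = L ** C ** (S ** transpose R ** R) ** S ** transpose C ** transpose L"
    by (simp add: Z_def matrix_transpose_mul symS matrix_mul_assoc)
  also have "\<dots> = mat 1"
    using LNL by (simp add: SRR N_def matrix_mul_assoc)
  finally have ZZ: "Z ** transpose Z = mat 1" .
  have Zrow: "Z $ a \<bullet> Z $ b = (if a = b then 1 else 0)" for a b
    using arg_cong[OF ZZ, of "\<lambda>X. X $ a $ b"]
    by (simp add: matrix_matrix_mult_def transpose_def inner_vec_def mat_def)
  obtain b where b: "bij_betw b {..<CARD('k)} (UNIV :: 'k set)"
    using finite_same_card_bij[of "{..<CARD('k)}" "UNIV :: 'k set"] by auto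
  have binj: "b i = b j \<longleftrightarrow> i = j" if "i < CARD('k)" "j < CARD('k)" for i j
    using b that by (auto simp: bij_betw_def inj_on_def)
  have zon: "orthonormal_family CARD('k) (\<lambda>i. Z $ b i)"
    by (simp add: orthonormal_family_def Zrow binj)
  obtain z where z: "orthonormal_family CARD('n) z" "\<forall>i<CARD('k). z i = Z $ b i"
    by (rule extend_orthonormal_eigenvectors[of "mat 1" "CARD('k)" "\<lambda>i. Z $ b i" "\<lambda>_. 1", OF _ zon])
      auto
  have kn: "CARD('k) \<le> CARD('n)" using orthonormal_family_le[OF zon] .
  obtain d where d: "bij_betw d (UNIV :: 'n set) {..<CARD('n)}"
    using finite_same_card_bij[of "UNIV :: 'n set" "{..<CARD('n)}"] by auto
  have dlt: "d j < CARD('n)" for j using bij_betwE[OF d] by auto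
  have dinj: "d i = d j \<longleftrightarrow> i = j" for i j
    using d by (auto simp: bij_betw_def inj_on_def)
  define e where "e = inv_into UNIV d"
  have de: "d (e i) = i" if "i < CARD('n)" for i
    using that d by (simp add: e_def f_inv_into_f bij_betw_def)
  define E where "E = (\<chi> j. z (d j))"
  have "E ** transpose E = mat 1"
    using orthonormal_familyD[OF z(1) dlt dlt]
    by (simp add: vec_eq_iff E_def matrix_matrix_mult_def transpose_def mat_def inner_vec_def dinj)
  then have EE: "transpose E ** E = mat 1" by (simp add: matrix_left_right_inverse)
  define Q where "Q = E ** R"
  have "transpose Q ** Q = transpose R ** (transpose E ** E) ** R"
    by (simp add: Q_def matrix_transpose_mul matrix_mul_assoc)
  then have "transpose Q ** Q = matrix_inv S" by (simp add: EE R)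
  moreover have "inj_on e {..<CARD('k)}"
    using de kn by (intro inj_on_inverseI[of _ d]) auto
  moreover have "(C *v x) \<bullet> (matrix_inv (C ** S ** transpose C) *v (C *v x))
      = (\<Sum>i<CARD('k). ((Q *v x) $ e i)\<^sup>2)" for x
  proof -
    have "(C *v x) \<bullet> (matrix_inv N *v (C *v x)) = (L *v (C *v x)) \<bullet> (L *v (C *v x))"
      by (simp only: L[symmetric] quadratic_form_factor)
    also have "\<dots> = (\<Sum>a\<in>UNIV. ((Z *v (R *v x)) $ a)\<^sup>2)"
      by (simp add: matrix_vector_mul_assoc ZR inner_vec_def power2_eq_square)
    also have "\<dots> = (\<Sum>i<CARD('k). ((Z *v (R *v x)) $ b i)\<^sup>2)"
      by (rule sum.reindex_bij_betw[OF b, symmetric])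
    also have "\<dots> = (\<Sum>i<CARD('k). ((Q *v x) $ e i)\<^sup>2)"
    proof (intro sum.cong refl)
      fix i assume "i \<in> {..<CARD('k)}"
      then have "(Q *v x) $ e i = z i \<bullet> (R *v x)" "z i = Z $ b i"
        using kn z(2) de
        by (simp_all add: Q_def matrix_vector_mul_assoc[symmetric] matrix_vector_mul_component E_def)
      then show "((Z *v (R *v x)) $ b i)\<^sup>2 = ((Q *v x) $ e i)\<^sup>2"
        by (simp add: matrix_vector_mul_component)
    qed
    finally show ?thesis by (simp add: N_def)
  qed
  ultimately show thesis by (rule that)
qed

lemma std_normal_density_prod:
  "(\<Prod>j\<in>UNIV. std_normal_density (y $ j)) = (1 / sqrt (2 * pi)) ^ CARD('n) * exp (- (y \<bullet> y) / 2)"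
  for y :: "real^'n"
  by (simp add: std_normal_density_def prod_dividef exp_sum[symmetric] prod.distrib inner_vec_def
      power2_eq_square sum_negf sum_divide_distrib power_divide)

text \<open>Substituting \<open>y = Q x\<close> turns the exponent into \<open>- \<bar>y\<bar>\<^sup>2 / 2\<close> and multiplies Lebesgue measure by an
unknown constant. The constant never has to be identified with a determinant: both sides are
multiples of the same measure and both have total mass one.\<close>

lemma distr_mvn_whitening:
  fixes S Q :: "real^'n^'n"
  assumes Q: "transpose Q ** Q = matrix_inv S" and inv: "invertible Q"
    and mass: "emeasure (mvn S) UNIV = 1"
  shows "distr (mvn S) borel ((*v) Q) = std_gaussian"
proof (rule measure_eqI)
  show "sets (distr (mvn S) borel ((*v) Q)) = sets std_gaussian" by simp
next
  fix A assume "A \<in> sets (distr (mvn S) borel ((*v) Q))"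
  then have A [measurable]: "A \<in> sets borel" by simp
  have Q_meas [measurable]: "(*v) Q \<in> borel_measurable borel"
    by (intro borel_measurable_continuous_onI linear_continuous_on matrix_vector_mul_bounded_linear)
  obtain c where c: "\<And>g. g \<in> borel_measurable borel \<Longrightarrow>
      (\<integral>\<^sup>+x. g (Q *v x) \<partial>lborel) = c * (\<integral>\<^sup>+x. g x \<partial>lborel)"
    using nn_integral_lborel_linear[of "(*v) Q"] inv by (auto simp: invertible_eq_bij)
  define k where "k = ennreal (1 / sqrt ((2 * pi) ^ CARD('n) * det S))"
  define w where "w = ennreal ((1 / sqrt (2 * pi)) ^ CARD('n))"
  define G :: "(real^'n) set \<Rightarrow> ennreal" where
    "G B = (\<integral>\<^sup>+y. ennreal (exp (- (y \<bullet> y) / 2)) * indicator B y \<partial>lborel)" for B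
  have mvn_eq: "emeasure (mvn S) ((*v) Q -` B) = c * k * G B" if [measurable]: "B \<in> sets borel" for B
  proof -
    have "(\<lambda>x. exp (- (x \<bullet> (matrix_inv S *v x)) / 2)) = (\<lambda>x. exp (- ((Q *v x) \<bullet> (Q *v x)) / 2))"
      by (simp add: Q[symmetric] quadratic_form_factor)
    then have "mvn S = density lborel (\<lambda>x. k * ennreal (exp (- ((Q *v x) \<bullet> (Q *v x)) / 2)))"
      unfolding mvn_def k_def by (simp add: ennreal_mult''[symmetric] fun_eq_iff)
    moreover have "(*v) Q -` B \<in> sets borel"
      using measurable_sets[OF Q_meas that] by simp
    ultimately have "emeasure (mvn S) ((*v) Q -` B)
        = (\<integral>\<^sup>+x. k * ennreal (exp (- ((Q *v x) \<bullet> (Q *v x)) / 2)) * indicator ((*v) Q -` B) x \<partial>lborel)"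
      by (simp add: emeasure_density)
    also have "\<dots> = (\<integral>\<^sup>+x. k * (ennreal (exp (- ((Q *v x) \<bullet> (Q *v x)) / 2)) * indicator B (Q *v x)) \<partial>lborel)"
      by (simp add: indicator_def mult.assoc)
    also have "\<dots> = c * (\<integral>\<^sup>+x. k * (ennreal (exp (- (x \<bullet> x) / 2)) * indicator B x) \<partial>lborel)"
      by (rule c) measurable
    also have "(\<integral>\<^sup>+x. k * (ennreal (exp (- (x \<bullet> x) / 2)) * indicator B x) \<partial>lborel) = k * G B"
      unfolding G_def by (rule nn_integral_cmult) measurable
    finally show ?thesis by (simp add: mult.assoc)
  qed
  have std_eq: "emeasure std_gaussian B = w * G B" if [measurable]: "B \<in> sets borel" for B
  proof -
    have "(\<Prod>j\<in>UNIV. ennreal (std_normal_density (y $ j))) = w * ennreal (exp (- (y \<bullet> y) / 2))" for y :: "real^'n"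
      unfolding prod_ennreal[of UNIV "\<lambda>j. std_normal_density (y $ j)", OF normal_density_nonneg] 
        std_normal_density_prod w_def
      by (rule ennreal_mult'') simp
    then have "emeasure std_gaussian B = (\<integral>\<^sup>+y. w * (ennreal (exp (- (y \<bullet> y) / 2)) * indicator B y) \<partial>lborel)"
      by (simp add: std_gaussian_def emeasure_density mult.assoc)
    also have "\<dots> = w * G B"
      unfolding G_def by (rule nn_integral_cmult) measurable
    finally show ?thesis .
  qed
  have 1: "c * k * G UNIV = 1" using mvn_eq[of UNIV] mass by simp
  have 2: "w * G UNIV = 1" using std_eq[of UNIV] by (simp add: emeasure_std_gaussian_UNIV)
  have "c * k = c * k * (w * G UNIV)" by (simp add: 2)
  also have "\<dots> = w * (c * k * G UNIV)" by (simp only: mult_ac)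
  also have "\<dots> = w" by (simp add: 1)
  finally have "c * k = w" .
  moreover have "emeasure (distr (mvn S) borel ((*v) Q)) A = emeasure (mvn S) ((*v) Q -` A)"
    by (subst emeasure_distr) (simp_all add: mvn_def)
  ultimately show "emeasure (distr (mvn S) borel ((*v) Q)) A = emeasure std_gaussian A"
    by (simp add: mvn_eq std_eq)
qed

text \<open>The mass assumption records that the density is normalised; for the covariance matrix at hand it is a
consequence of the central limit theorem assumed for the sample (\<open>emeasure_mvn_eq_1\<close> below).\<close>

lemma distr_mvn_quadratic_form:
  fixes S :: "real^'n^'n" and C :: "real^'n^'k"
  assumes S: "pos_def S" and CSC: "pos_def (C ** S ** transpose C)"
    and mass: "emeasure (mvn S) UNIV = 1"
  shows "distr (mvn S) borel (\<lambda>x. (C *v x) \<bullet> (matrix_inv (C ** S ** transpose C) *v (C *v x)))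
    = chi_squared CARD('k)"
proof -
  obtain Q :: "real^'n^'n" and e :: "nat \<Rightarrow> 'n"
    where Q: "transpose Q ** Q = matrix_inv S" and e: "inj_on e {..<CARD('k)}"
    and eq: "\<And>x. (C *v x) \<bullet> (matrix_inv (C ** S ** transpose C) *v (C *v x))
      = (\<Sum>i<CARD('k). ((Q *v x) $ e i)\<^sup>2)"
    by (rule whitening_transformation[OF S CSC]) blast
  have "(S ** transpose Q) ** Q = mat 1"
    using matrix_inv_right[OF pos_def_imp_invertible[OF S]] by (simp add: matrix_mul_assoc[symmetric] Q)
  then have inv: "invertible Q" by (auto simp: invertible_left_inverse)
  have [measurable]: "(*v) Q \<in> borel_measurable borel"
    by (intro borel_measurable_continuous_onI linear_continuous_on matrix_vector_mul_bounded_linear)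
  have [measurable_cong]: "sets (mvn S) = sets borel" by (simp add: mvn_def)
  have "distr (mvn S) borel (\<lambda>x. \<Sum>i<CARD('k). ((Q *v x) $ e i)\<^sup>2)
      = distr (distr (mvn S) borel ((*v) Q)) borel (\<lambda>y. \<Sum>i<CARD('k). (y $ e i)\<^sup>2)"
    by (subst distr_distr) (simp_all add: comp_def)
  also have "\<dots> = chi_squared CARD('k)"
    unfolding distr_mvn_whitening[OF Q inv mass] by (rule chi_squared_std_gaussian[OF e])
  finally show ?thesis by (simp add: eq)
qed

section \<open>Limits of split singular value decompositions\<close>

lemma kron_mult: "(A \<otimes>\<^sub>K B) ** (C \<otimes>\<^sub>K D) = (A ** C) \<otimes>\<^sub>K (B ** D)"
  by (simp add: vec_eq_iff kron_def matrix_matrix_mult_def sum_product sum.cartesian_product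
      UNIV_Times_UNIV[symmetric] case_prod_beta mult_ac del: UNIV_Times_UNIV)

lemma kron_mat_1: "(mat 1 :: real^'a^'a) \<otimes>\<^sub>K (mat 1 :: real^'b^'b) = mat 1"
  by (simp add: vec_eq_iff kron_def mat_def prod_eq_iff)

lemma transpose_kron: "transpose (A \<otimes>\<^sub>K B) = transpose A \<otimes>\<^sub>K transpose B"
  by (simp add: vec_eq_iff kron_def transpose_def)

lemma diag_mult: "(diag s ** A) $ i $ j = s $ i * A $ i $ j"
  by (simp add: matrix_matrix_mult_def diag_def if_distrib[of "\<lambda>x. x * _"] cong: if_cong)

lemma mult_diag: "(A ** diag s) $ i $ j = A $ i $ j * s $ j"
  by (simp add: matrix_matrix_mult_def diag_def if_distrib[of "\<lambda>x. _ * x"] cong: if_cong)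

lemma transpose_diag [simp]: "transpose (diag s) = diag s"
  by (auto simp: vec_eq_iff transpose_def diag_def)

lemma diag_inverse:
  assumes "\<And>a. s $ a \<noteq> 0"
  shows "diag (\<chi> a. inverse (s $ a)) ** diag s = mat 1" "diag s ** diag (\<chi> a. inverse (s $ a)) = mat 1"
    "matrix_inv (diag s) = diag (\<chi> a. inverse (s $ a))"
proof -
  show *: "diag (\<chi> a. inverse (s $ a)) ** diag s = mat 1"
    using assms by (simp add: vec_eq_iff diag_mult) (simp add: diag_def mat_def)
  then show "diag s ** diag (\<chi> a. inverse (s $ a)) = mat 1"
    by (simp add: matrix_left_right_inverse)
  show "matrix_inv (diag s) = diag (\<chi> a. inverse (s $ a))"
    using * by (rule matrix_inv_unique)
qed

lemma orthonormal_cols_hcat: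
  "orthonormal_cols (hcat A B) \<longleftrightarrow> transpose A ** A = mat 1 \<and> transpose A ** B = 0 \<and>
    transpose B ** A = 0 \<and> transpose B ** B = mat 1"
proof -
  have "(transpose (hcat A B) ** hcat A B) $ Inl a $ Inl a' = (transpose A ** A) $ a $ a'"
    "(transpose (hcat A B) ** hcat A B) $ Inl a $ Inr b' = (transpose A ** B) $ a $ b'"
    "(transpose (hcat A B) ** hcat A B) $ Inr b $ Inl a' = (transpose B ** A) $ b $ a'"
    "(transpose (hcat A B) ** hcat A B) $ Inr b $ Inr b' = (transpose B ** B) $ b $ b'" for a a' b b'
    by (simp_all add: matrix_matrix_mult_def transpose_def hcat_def)
  then show ?thesis
    unfolding orthonormal_cols_def vec_eq_iff split_sum_all by (auto simp: mat_def)
qed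

lemma orthonormal_rows_hcat:
  "orthonormal_cols (transpose (hcat A B)) \<longleftrightarrow> A ** transpose A + B ** transpose B = mat 1"
proof -
  have "hcat A B ** transpose (hcat A B) = A ** transpose A + B ** transpose B"
    by (simp add: vec_eq_iff matrix_matrix_mult_def transpose_def hcat_def sum.Plus
        flip: UNIV_Plus_UNIV)
  then show ?thesis by (simp add: orthonormal_cols_def)
qed

lemmas matrix_mult_zero = bounded_bilinear.zero_left[OF bounded_bilinear_matrix_mult]
  bounded_bilinear.zero_right[OF bounded_bilinear_matrix_mult]

lemma split_svdD:
  assumes "is_split_svd M UI sI VI UJ sJ VJ"
  shows "transpose UI ** UI = mat 1" "transpose VI ** VI = mat 1"
    "UJ ** transpose UJ = mat 1 - UI ** transpose UI"
    "M ** VI = UI ** diag sI" "transpose UI ** M = diag sI ** transpose VI"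
proof -
  have o: "transpose UI ** UI = mat 1" "transpose UI ** UJ = 0" "transpose VI ** VI = mat 1"
    "transpose VJ ** VI = 0" "UI ** transpose UI + UJ ** transpose UJ = mat 1"
    and M: "M = UI ** diag sI ** transpose VI + UJ ** diag sJ ** transpose VJ"
    using assms by (auto simp: is_split_svd_def orthonormal_cols_hcat orthonormal_rows_hcat)
  show "transpose UI ** UI = mat 1" "transpose VI ** VI = mat 1" by (rule o)+
  show "UJ ** transpose UJ = mat 1 - UI ** transpose UI"
    using o(5) by (simp add: eq_diff_eq add.commute)
  show "M ** VI = UI ** diag sI"
    unfolding M bounded_bilinear.add_left[OF bounded_bilinear_matrix_mult]
    by (simp add: matrix_mul_assoc[symmetric] o matrix_mult_zero)
  have "transpose UI ** M = (transpose UI ** UI) ** (diag sI ** transpose VI)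
      + (transpose UI ** UJ) ** (diag sJ ** transpose VJ)"
    unfolding M matrix_add_ldistrib by (simp add: matrix_mul_assoc)
  then show "transpose UI ** M = diag sI ** transpose VI" by (simp add: o matrix_mult_zero)
qed

lemma orthonormal_cols_entry:
  fixes A :: "real^'n^'m"
  assumes "transpose A ** A = mat 1"
  shows "\<bar>A $ i $ a\<bar> \<le> 1"
proof -
  have "(A $ i $ a)\<^sup>2 \<le> (\<Sum>i\<in>UNIV. (A $ i $ a)\<^sup>2)"
    by (rule member_le_sum) auto
  also have "\<dots> = (transpose A ** A) $ a $ a"
    by (simp add: matrix_matrix_mult_def transpose_def power2_eq_square)
  finally show ?thesis using assms by (simp add: mat_def abs_square_le_1)
qed

lemma orthonormal_cols_norm:
  fixes A :: "real^'n^'m"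
  assumes "transpose A ** A = mat 1"
  shows "norm A \<le> real CARD('m) * real CARD('n)"
proof -
  have "norm A \<le> (\<Sum>i\<in>UNIV. norm (A $ i))"
    unfolding norm_vec_def by (rule L2_set_le_sum) simp
  also have "\<dots> \<le> (\<Sum>i\<in>(UNIV::'m set). \<Sum>a\<in>(UNIV::'n set). 1)"
    by (intro sum_mono order_trans[OF norm_le_l1_cart] orthonormal_cols_entry assms)
  finally show ?thesis by simp
qed

text \<open>Each trailing singular value is at most each leading one, so a single leading singular value controls
the whole part of the matrix outside the leading block.\<close>

lemma split_svd_residual_entry:
  fixes UJ :: "real^'j^'m"
  assumes svd: "is_split_svd M UI sI VI UJ sJ VJ"
  shows "\<bar>(M - UI ** diag sI ** transpose VI) $ i $ k\<bar> \<le> real CARD('j) * sI $ a"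
proof -
  have o: "transpose UJ ** UJ = mat 1" "transpose VJ ** VJ = mat 1"
    and M: "M = UI ** diag sI ** transpose VI + UJ ** diag sJ ** transpose VJ"
    and sJ: "0 \<le> sJ $ b" "sJ $ b \<le> sI $ a" for b
    using svd by (auto simp: is_split_svd_def orthonormal_cols_hcat)
  have "(M - UI ** diag sI ** transpose VI) $ i $ k = (UJ ** diag sJ ** transpose VJ) $ i $ k"
    by (simp add: M)
  also have "\<dots> = (\<Sum>b\<in>UNIV. UJ $ i $ b * sJ $ b * VJ $ k $ b)"
    by (simp add: matrix_matrix_mult_def[of "UJ ** diag sJ"] mult_diag transpose_def)
  also have "\<bar>\<dots>\<bar> \<le> (\<Sum>b\<in>UNIV. \<bar>UJ $ i $ b * sJ $ b * VJ $ k $ b\<bar>)"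
    by (rule sum_abs)
  also have "\<dots> \<le> (\<Sum>b\<in>(UNIV :: 'j set). sI $ a)"
  proof (rule sum_mono)
    fix b
    have "\<bar>UJ $ i $ b * sJ $ b * VJ $ k $ b\<bar> = \<bar>UJ $ i $ b\<bar> * (\<bar>sJ $ b\<bar> * \<bar>VJ $ k $ b\<bar>)"
      by (simp add: abs_mult)
    also have "\<dots> \<le> 1 * (\<bar>sJ $ b\<bar> * 1)"
      by (intro mult_mono orthonormal_cols_entry o) auto
    finally show "\<bar>UJ $ i $ b * sJ $ b * VJ $ k $ b\<bar> \<le> sI $ a"
      using sJ[of b] by simp
  qed
  finally show ?thesis by simp
qed

text \<open>Limits of split decompositions are again decompositions of the limit matrix, at least for the leading
block. The singular values converge because they are the diagonal of \<open>U\<^sup>T M V\<close>. The rank condition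
enters only to keep them away from zero.\<close>

lemma split_svd_limit:
  fixes M :: "real^'l^'m" and U :: "nat \<Rightarrow> real^'q^'m" and UJ :: "nat \<Rightarrow> real^'j^'m"
  assumes svd: "\<And>n. is_split_svd (Mh n) (U n) (s n) (V n) (UJ n) (sJ n) (VJ n)"
    and Mh: "Mh \<longlonglongrightarrow> M" and U: "U \<longlonglongrightarrow> U'" and V: "V \<longlonglongrightarrow> V'"
    and rank: "rank M = CARD('q)"
  obtains s' where "s \<longlonglongrightarrow> s'" "\<And>a. 0 < s' $ a" "transpose U' ** U' = mat 1" "transpose V' ** V' = mat 1"
    "M ** V' = U' ** diag s'" "transpose U' ** M = diag s' ** transpose V'"
proof -
  note o = split_svdD[OF svd]
  have UU: "transpose U' ** U' = mat 1"
  proof (rule LIMSEQ_unique)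
    show "(\<lambda>n. transpose (U n) ** U n) \<longlonglongrightarrow> transpose U' ** U'" by (intro tendsto_intros U)
    show "(\<lambda>n. transpose (U n) ** U n) \<longlonglongrightarrow> mat 1" by (simp add: o)
  qed
  have VV: "transpose V' ** V' = mat 1"
  proof (rule LIMSEQ_unique)
    show "(\<lambda>n. transpose (V n) ** V n) \<longlonglongrightarrow> transpose V' ** V'" by (intro tendsto_intros V)
    show "(\<lambda>n. transpose (V n) ** V n) \<longlonglongrightarrow> mat 1" by (simp add: o)
  qed
  define s' where "s' = (\<chi> a. (transpose U' ** (M ** V')) $ a $ a)"
  have "s n = (\<chi> a. (transpose (U n) ** (Mh n ** V n)) $ a $ a)" for n
    by (simp add: o vec_eq_iff matrix_mul_assoc mult_diag mat_def)
  then have "s = (\<lambda>n. \<chi> a. (transpose (U n) ** (Mh n ** V n)) $ a $ a)" by (rule ext)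
  moreover have "(\<lambda>n. \<chi> a. (transpose (U n) ** (Mh n ** V n)) $ a $ a) \<longlonglongrightarrow> s'"
    unfolding s'_def by (intro tendsto_intros U V Mh)
  ultimately have s: "s \<longlonglongrightarrow> s'" by simp
  have MV: "M ** V' = U' ** diag s'"
  proof (rule LIMSEQ_unique)
    show "(\<lambda>n. Mh n ** V n) \<longlonglongrightarrow> M ** V'" by (intro tendsto_intros Mh V)
    show "(\<lambda>n. Mh n ** V n) \<longlonglongrightarrow> U' ** diag s'"
      unfolding o(4) by (intro tendsto_intros U s)
  qed
  have UM: "transpose U' ** M = diag s' ** transpose V'"
  proof (rule LIMSEQ_unique)
    show "(\<lambda>n. transpose (U n) ** Mh n) \<longlonglongrightarrow> transpose U' ** M" by (intro tendsto_intros Mh U)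
    show "(\<lambda>n. transpose (U n) ** Mh n) \<longlonglongrightarrow> diag s' ** transpose V'"
      unfolding o(5) by (intro tendsto_intros V s)
  qed
  have "0 < s' $ a" for a
  proof (rule ccontr)
    assume "\<not> 0 < s' $ a"
    have sa: "(\<lambda>n. s n $ a) \<longlonglongrightarrow> s' $ a" by (intro tendsto_intros s)
    have "0 \<le> s' $ a"
      by (rule LIMSEQ_le_const[OF sa]) (use svd in \<open>auto simp: is_split_svd_def\<close>)
    with \<open>\<not> 0 < s' $ a\<close> have s0: "s' $ a = 0" by simp
    (* A vanishing leading singular value squeezes all trailing ones to zero, so the limit would
       factor through a singular diagonal matrix. *)
    have "(M - U' ** diag s' ** transpose V') $ i $ k = 0" for i k
    proof (rule LIMSEQ_unique)
      show "(\<lambda>n. (Mh n - U n ** diag (s n) ** transpose (V n)) $ i $ k)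
          \<longlonglongrightarrow> (M - U' ** diag s' ** transpose V') $ i $ k"
        by (intro tendsto_intros Mh U V s)
      show "(\<lambda>n. (Mh n - U n ** diag (s n) ** transpose (V n)) $ i $ k) \<longlonglongrightarrow> 0"
      proof (rule Lim_null_comparison)
        show "\<forall>\<^sub>F n in sequentially. norm ((Mh n - U n ** diag (s n) ** transpose (V n)) $ i $ k)
            \<le> real CARD('j) * s n $ a"
          using split_svd_residual_entry[OF svd] by (auto intro!: always_eventually)
        have "(\<lambda>n. real CARD('j) * s n $ a) \<longlonglongrightarrow> real CARD('j) * s' $ a" by (intro tendsto_intros s)
        then show "(\<lambda>n. real CARD('j) * s n $ a) \<longlonglongrightarrow> 0" by (simp add: s0)
      qed
    qed
    then have "M = U' ** diag s' ** transpose V'" by (simp add: vec_eq_iff)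
    then have "rank M \<le> rank (diag s')"
      by (metis rank_mul_le_left rank_mul_le_right order_trans)
    then have "rank (diag s') = CARD('q)"
      using rank rank_bound[of "diag s'"] by simp
    then have "inj ((*v) (diag s'))" by (simp add: full_rank_injective)
    moreover have "diag s' *v axis a 1 = diag s' *v 0"
      using s0 by (auto simp: matrix_vector_mult_basis column_def diag_def vec_eq_iff)
    ultimately have "axis a (1::real) = 0" by (rule injD)
    then show False by (simp add: axis_eq_0_iff)
  qed
  then show thesis using that s UU VV MV UM by blast
qed

text \<open>Comparing the two decompositions through \<open>W = U\<^sub>I\<^sup>T U'\<close> and \<open>X = V\<^sub>I\<^sup>T V'\<close> gives
\<open>\<Sigma>\<^sub>I X = W \<Sigma>'\<close> and \<open>\<Sigma>\<^sub>I W = X \<Sigma>'\<close>, so \<open>W\<^sub>b\<^sub>a\<close> can be nonzero only if \<open>\<iota>\<^sub>b = \<iota>'\<^sub>a\<close>. As the \<open>\<iota>\<^sub>b\<close> are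
distinct, each column of the orthogonal matrix \<open>W\<close> has a single nonzero entry; two equal \<open>\<iota>'\<close> would
put two orthogonal columns on the same entry.\<close>

lemma split_svd_unique_up_to_rotation:
  fixes M :: "real^'l^'m" and UI U' :: "real^'q^'m" and UJ :: "real^'j^'m"
  assumes svd: "is_split_svd M UI sI VI UJ 0 VJ"
    and pos: "\<And>a. 0 < sI $ a" and distinct: "\<And>a b. a \<noteq> b \<Longrightarrow> sI $ a \<noteq> sI $ b"
    and U': "transpose U' ** U' = mat 1" and V': "transpose V' ** V' = mat 1"
    and s': "\<And>a. 0 < s' $ a"
    and MV: "M ** V' = U' ** diag s'" and UM: "transpose U' ** M = diag s' ** transpose V'"
  obtains W P where "U' = UI ** W" "diag (\<chi> a. inverse (s' $ a)) ** transpose V' = P ** transpose VI"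
    "invertible P" "\<And>a b. a \<noteq> b \<Longrightarrow> s' $ a \<noteq> s' $ b"
proof -
  note o = split_svdD[OF svd]
  define t where "t = (\<chi> a. inverse (s' $ a))"
  have s'0: "s' $ a \<noteq> 0" for a using s'[of a] by simp
  note dt = diag_inverse[OF s'0, folded t_def]
  have "diag (0::real^'j) = 0" by (simp add: vec_eq_iff diag_def)
  then have M: "M = UI ** diag sI ** transpose VI"
    using svd by (simp add: is_split_svd_def matrix_mult_zero)
  define X where "X = transpose VI ** V'"
  define W where "W = transpose UI ** U'"
  have "U' = U' ** diag s' ** diag t" by (simp add: matrix_mul_assoc[symmetric] dt)
  also have "\<dots> = UI ** (diag sI ** X ** diag t)"
    by (simp add: MV[symmetric] M X_def matrix_mul_assoc)
  finally have "U' = UI ** (diag sI ** X ** diag t)" .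
  moreover from this have "W = diag sI ** X ** diag t"
    unfolding W_def by (metis matrix_mul_assoc matrix_mul_lid o(1))
  ultimately have UW: "U' = UI ** W" by simp
  have "transpose W ** W = transpose W ** (transpose UI ** UI) ** W" by (simp add: o)
  also have "\<dots> = mat 1"
    using U' by (simp add: UW matrix_transpose_mul matrix_mul_assoc)
  finally have WW: "transpose W ** W = mat 1" .
  have 1: "diag sI ** X = W ** diag s'"
  proof -
    have "W ** diag s' = transpose UI ** (M ** V')" by (simp add: W_def MV matrix_mul_assoc)
    also have "\<dots> = diag sI ** X" by (simp add: o(5) X_def matrix_mul_assoc)
    finally show ?thesis by simp
  qed
  have "transpose W ** diag sI = diag s' ** transpose X"
  proof -
    have "transpose W ** diag sI = transpose U' ** (M ** VI)"
      by (simp add: W_def o(4) matrix_transpose_mul matrix_mul_assoc)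
    also have "\<dots> = diag s' ** transpose X" by (simp add: UM X_def matrix_transpose_mul matrix_mul_assoc)
    finally show ?thesis .
  qed
  from arg_cong[OF this, of transpose] have 2: "diag sI ** W = X ** diag s'"
    by (simp add: matrix_transpose_mul)
  have supp: "sI $ b = s' $ a" if "W $ b $ a \<noteq> 0" for a b
  proof -
    have "sI $ b * X $ b $ a = W $ b $ a * s' $ a" "sI $ b * W $ b $ a = X $ b $ a * s' $ a"
      using 1 2 by (metis diag_mult mult_diag)+
    then have "(sI $ b)\<^sup>2 * W $ b $ a = (s' $ a)\<^sup>2 * W $ b $ a"
      by (simp add: power2_eq_square mult.assoc mult.left_commute)
    then have "(sI $ b)\<^sup>2 = (s' $ a)\<^sup>2" using that by simp
    then show ?thesis using pos[of b] s'[of a] by (simp add: power2_eq_iff_nonneg)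
  qed
  have WWe: "(\<Sum>b\<in>UNIV. W $ b $ a * W $ b $ a') = (if a = a' then 1 else 0)" for a a'
    using arg_cong[OF WW, of "\<lambda>X. X $ a $ a'"]
    by (simp add: matrix_matrix_mult_def transpose_def mat_def)
  have nz: "\<exists>b. W $ b $ a \<noteq> 0" for a
  proof (rule ccontr)
    assume "\<not> ?thesis"
    then show False using WWe[of a a] by simp
  qed
  have dist: "s' $ a \<noteq> s' $ a'" if "a \<noteq> a'" for a a'
  proof
    assume eq: "s' $ a = s' $ a'"
    obtain b b' where b: "W $ b $ a \<noteq> 0" "W $ b' $ a' \<noteq> 0" using nz by blast
    then have "sI $ b = sI $ b'" using supp[of b a] supp[of b' a'] eq by simp
    then have bb: "b' = b" using distinct[of b b'] by auto
    have "W $ c $ a = 0" if "c \<noteq> b" for c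
      using supp[of c a] supp[of b a] b distinct[of c b] that by auto
    then have "(\<Sum>c\<in>UNIV. W $ c $ a * W $ c $ a') = (\<Sum>c\<in>{b}. W $ c $ a * W $ c $ a')"
      by (intro sum.mono_neutral_right) auto
    then show False using WWe[of a a'] that b bb by simp
  qed
  define P where "P = diag t ** diag t ** transpose W ** diag sI"
  have "diag t ** transpose V' = diag t ** (diag t ** diag s') ** transpose V'"
    by (simp add: dt)
  also have "\<dots> = diag t ** diag t ** (transpose U' ** M)"
    by (simp add: UM matrix_mul_assoc)
  also have "\<dots> = diag t ** diag t ** transpose W ** ((transpose UI ** UI) ** diag sI ** transpose VI)"
    by (simp add: UW matrix_transpose_mul M matrix_mul_assoc)
  finally have P: "diag t ** transpose V' = P ** transpose VI"
    by (simp add: o(1) P_def matrix_mul_assoc)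
  have "P ** (transpose VI ** V' ** diag s') = diag t ** (transpose V' ** V') ** diag s'"
    by (simp add: matrix_mul_assoc P[symmetric])
  also have "\<dots> = mat 1" by (simp add: V' dt)
  finally have "invertible P" unfolding invertible_right_inverse by blast
  with that[OF UW P[unfolded t_def]] dist show thesis by blast
qed

text \<open>In the limit \<open>\<upsilon>\<^sup>T U'\<close> vanishes, which removes the second summand of \<^const>\<open>B_SVD\<close> and turns
\<open>\<upsilon>\<^sup>T U\<^sub>J U\<^sub>J\<^sup>T = \<upsilon>\<^sup>T - \<upsilon>\<^sup>T U U\<^sup>T\<close> into \<open>\<upsilon>\<^sup>T\<close>. The trailing vectors \<open>U\<^sub>J\<close> need not converge; they enter
only through this projection.\<close>

lemma B_SVD_tendsto:
  fixes U :: "nat \<Rightarrow> real^'q^'m" and UJ :: "nat \<Rightarrow> real^'j^'m" and \<upsilon> :: "real^'r^'m"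
  assumes U: "U \<longlonglongrightarrow> U'" and V: "V \<longlonglongrightarrow> V'" and s: "s \<longlonglongrightarrow> s'"
    and s'0: "\<And>a. s' $ a \<noteq> 0" and distinct: "\<And>a b. a \<noteq> b \<Longrightarrow> (s' $ a)\<^sup>2 \<noteq> (s' $ b)\<^sup>2"
    and UJ: "\<And>n. UJ n ** transpose (UJ n) = mat 1 - U n ** transpose (U n)"
    and null: "transpose \<upsilon> ** U' = 0"
  shows "(\<lambda>n. B_SVD \<upsilon> (U n) (s n) (V n) (UJ n)) \<longlonglongrightarrow>
    (diag (\<chi> a. inverse (s' $ a)) ** transpose V') \<otimes>\<^sub>K transpose \<upsilon>"
proof -
  have inv: "invertible (diag s')"
    using diag_inverse(1)[of s', OF s'0] by (rule matrix_inv_unique)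
  have D: "(\<lambda>n. D_d (s n)) \<longlonglongrightarrow> D_d s'"
    unfolding D_d_def
  proof (intro tendsto_vec_lambda)
    fix i j
    show "(\<lambda>n. if i = j then 0 else inverse ((s n $ i)\<^sup>2 - (s n $ j)\<^sup>2))
      \<longlonglongrightarrow> (if i = j then 0 else inverse ((s' $ i)\<^sup>2 - (s' $ j)\<^sup>2))"
      using distinct[of i j] by (cases "i = j") (auto intro!: tendsto_intros s)
  qed
  have inv_lim: "(\<lambda>n. matrix_inv (diag (s n))) \<longlonglongrightarrow> matrix_inv (diag s')"
    by (intro tendsto_matrix_inv(1) inv tendsto_intros s)
  have "(\<lambda>n. (transpose (matrix_inv (diag (s n))) ** transpose (V n)) \<otimes>\<^sub>K
        (transpose \<upsilon> ** (mat 1 - U n ** transpose (U n)))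
      + (mat 1 \<otimes>\<^sub>K (transpose \<upsilon> ** U n)) **
       (outer (vec_of (D_d (s n))) 1 \<circ>\<^sub>H
         ((transpose (diag (s n)) ** transpose (V n)) \<otimes>\<^sub>K transpose (U n)
          + (transpose (U n) \<otimes>\<^sub>K (diag (s n) ** transpose (V n))) ** commutation)))
    \<longlonglongrightarrow> (transpose (matrix_inv (diag s')) ** transpose V') \<otimes>\<^sub>K
        (transpose \<upsilon> ** (mat 1 - U' ** transpose U'))
      + (mat 1 \<otimes>\<^sub>K (transpose \<upsilon> ** U')) **
       (outer (vec_of (D_d s')) 1 \<circ>\<^sub>H
         ((transpose (diag s') ** transpose V') \<otimes>\<^sub>K transpose U'
          + (transpose U' \<otimes>\<^sub>K (diag s' ** transpose V')) ** commutation))" (is "_ \<longlonglongrightarrow> ?L")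
    by (intro tendsto_intros inv_lim D U V s)
  moreover have "?L = (diag (\<chi> a. inverse (s' $ a)) ** transpose V') \<otimes>\<^sub>K transpose \<upsilon>"
  proof -
    have "transpose \<upsilon> ** (mat 1 - U' ** transpose U') = transpose \<upsilon>"
      by (simp add: bounded_bilinear.diff_right[OF bounded_bilinear_matrix_mult] matrix_mul_assoc
          null matrix_mult_zero)
    then show ?thesis
      by (simp add: diag_inverse(3)[of s', OF s'0] null matrix_mult_zero
          bounded_bilinear.zero_right[OF bounded_bilinear_kron])
  qed
  ultimately show ?thesis
    by (simp add: B_SVD_def matrix_mul_assoc[symmetric] UJ)
qed

text \<open>Multiplying \<open>Mh V\<^sub>I = U\<^sub>I \<Sigma>\<^sub>I\<close> by \<open>\<upsilon>\<^sup>T\<close> and subtracting \<open>\<upsilon>\<^sup>T M = 0\<close> expresses the contrast through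
\<open>Mh - M\<close> without any remainder; no expansion of singular vectors is involved.\<close>

lemma contrast_linear_in_error:
  fixes \<upsilon> :: "real^'r^'m"
  assumes svd: "is_split_svd Mh UI sI VI UJ sJ VJ" and s0: "\<And>a. sI $ a \<noteq> 0"
    and null: "transpose \<upsilon> ** M = 0"
  shows "vec_of (transpose \<upsilon> ** UI)
    = ((diag (\<chi> a. inverse (sI $ a)) ** transpose VI) \<otimes>\<^sub>K transpose \<upsilon>) *v vec_of (Mh - M)"
proof -
  define t where "t = (\<chi> a. inverse (sI $ a))"
  note dt = diag_inverse[of sI, OF s0, folded t_def]
  have "transpose \<upsilon> ** UI = transpose \<upsilon> ** (UI ** diag sI) ** diag t"
    by (simp add: matrix_mul_assoc[symmetric] dt)
  also have "\<dots> = transpose \<upsilon> ** Mh ** (VI ** diag t)"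
    by (simp add: split_svdD(4)[OF svd, symmetric] matrix_mul_assoc)
  also have "transpose \<upsilon> ** Mh = transpose \<upsilon> ** (Mh - M)"
    by (simp add: bounded_bilinear.diff_right[OF bounded_bilinear_matrix_mult] null)
  finally show ?thesis
    by (simp add: vec_of_mult matrix_transpose_mul t_def)
qed

text \<open>The form \<open>A\<^sup>T (A S A\<^sup>T)\<^sup>-\<^sup>1 A\<close> depends on \<open>A\<close> only through its row space. This absorbs the unknown
order and signs of the sample singular vectors.\<close>

lemma projected_form_invariant:
  fixes C :: "real^'n^'k" and R :: "real^'k^'k"
  assumes R: "invertible R" and N: "invertible (C ** S ** transpose C)"
  shows "transpose (R ** C) ** matrix_inv ((R ** C) ** S ** transpose (R ** C)) ** (R ** C)
      = transpose C ** matrix_inv (C ** S ** transpose C) ** C"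
    and "invertible ((R ** C) ** S ** transpose (R ** C))"
proof -
  define N' where "N' = C ** S ** transpose C"
  define Ri where "Ri = matrix_inv R"
  have Ri: "Ri ** R = mat 1" "R ** Ri = mat 1"
    unfolding Ri_def using R by (rule matrix_inv_left, rule matrix_inv_right)
  then have Rt: "transpose R ** transpose Ri = mat 1" "transpose Ri ** transpose R = mat 1"
    by (metis matrix_transpose_mul transpose_mat)+
  have eq: "(R ** C) ** S ** transpose (R ** C) = R ** N' ** transpose R"
    by (simp add: N'_def matrix_transpose_mul matrix_mul_assoc)
  have "(transpose Ri ** matrix_inv N' ** Ri) ** (R ** N' ** transpose R)
      = transpose Ri ** matrix_inv N' ** (Ri ** R) ** N' ** transpose R"
    by (simp only: matrix_mul_assoc)
  also have "\<dots> = transpose Ri ** (matrix_inv N' ** N') ** transpose R"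
    by (simp add: Ri matrix_mul_assoc)
  also have "\<dots> = mat 1"
    using N by (simp add: N'_def matrix_inv_left Rt)
  finally have *: "(transpose Ri ** matrix_inv N' ** Ri) ** (R ** N' ** transpose R) = mat 1" .
  show "invertible ((R ** C) ** S ** transpose (R ** C))"
    unfolding eq by (rule matrix_inv_unique[OF *])
  have "transpose (R ** C) ** matrix_inv ((R ** C) ** S ** transpose (R ** C)) ** (R ** C)
      = transpose C ** (transpose R ** transpose Ri) ** matrix_inv N' ** (Ri ** R) ** C"
    unfolding eq matrix_inv_unique(1)[OF *] by (simp only: matrix_transpose_mul matrix_mul_assoc)
  also have "\<dots> = transpose C ** matrix_inv N' ** C" by (simp add: Ri Rt)
  finally show "transpose (R ** C) ** matrix_inv ((R ** C) ** S ** transpose (R ** C)) ** (R ** C)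
      = transpose C ** matrix_inv (C ** S ** transpose C) ** C" by (simp add: N'_def)
qed

lemma pos_def_kron_congruence:
  fixes VI :: "real^'q^'l" and \<upsilon> :: "real^'r^'m"
  assumes S: "pos_def S" and V: "transpose VI ** VI = mat 1" and \<upsilon>: "rank \<upsilon> = CARD('r)"
  shows "pos_def ((transpose VI \<otimes>\<^sub>K transpose \<upsilon>) ** S ** transpose (transpose VI \<otimes>\<^sub>K transpose \<upsilon>))"
proof (rule pos_def_congruence[OF S])
  fix x :: "real^('q \<times> 'r)"
  assume "transpose (transpose VI \<otimes>\<^sub>K transpose \<upsilon>) *v x = 0"
  then have 0: "(VI \<otimes>\<^sub>K \<upsilon>) *v x = 0" by (simp only: transpose_kron transpose_transpose)
  obtain L where L: "L ** \<upsilon> = mat 1"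
    using \<upsilon> by (auto simp: full_rank_injective matrix_left_invertible_injective[symmetric])
  have "(transpose VI \<otimes>\<^sub>K L) *v ((VI \<otimes>\<^sub>K \<upsilon>) *v x) = x"
    by (simp add: matrix_vector_mul_assoc kron_mult V L kron_mat_1)
  then show "x = 0" by (simp add: 0)
qed

text \<open>A compactness argument replaces the perturbation theory of singular vectors. If the bound failed for
every \<open>\<delta>\<close>, there would be decompositions of matrices converging to \<open>M\<close> that violate it. Their
singular vectors lie in a bounded set, so a subsequence converges to a decomposition of \<open>M\<close>; along it
both the contrast map \<open>A\<close> and \<^const>\<open>B_SVD\<close> converge to \<open>R C\<close> with \<open>R\<close> invertible, and the two
quadratic forms have the same limit by invariance. The difference of the forms is then eventually
smaller than \<open>\<eta>\<close>. The factor \<open>T\<close> of the statistic is left out because both sides are homogeneous of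
degree two in the estimation error.\<close>

lemma statistic_uniform_approximation:
  fixes M :: "real^'l^'m"
    and UI :: "real^'q^'m" and sI :: "real^'q" and VI :: "real^'q^'l"
    and UJ :: "real^'j^'m" and VJ :: "real^'j^'l" and S :: "real^('l \<times> 'm)^('l \<times> 'm)"
    and \<upsilon> :: "real^'r^'m"
  defines "C \<equiv> transpose VI \<otimes>\<^sub>K transpose \<upsilon>"
  assumes rank: "rank M = CARD('q)"
    and svd_M: "is_split_svd M UI sI VI UJ 0 VJ"
    and pos: "\<And>a. 0 < sI $ a" and distinct: "\<And>a b. a \<noteq> b \<Longrightarrow> sI $ a \<noteq> sI $ b"
    and S: "pos_def S" and \<upsilon>: "rank \<upsilon> = CARD('r)" and null: "transpose \<upsilon> ** UI = 0"
    and \<eta>: "0 < \<eta>"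
  obtains \<delta> where "0 < \<delta>"
    "\<And>Mh Om (U :: real^'q^'m) s V (UJ :: real^'j^'m) sJ VJ. is_split_svd Mh U s V UJ sJ VJ \<Longrightarrow>
      dist Mh M \<le> \<delta> \<Longrightarrow> dist Om S \<le> \<delta> \<Longrightarrow>
      \<bar>vec_of (transpose \<upsilon> ** U) \<bullet>
          (ginv (B_SVD \<upsilon> U s V UJ ** Om ** transpose (B_SVD \<upsilon> U s V UJ)) *v vec_of (transpose \<upsilon> ** U))
        - (C *v vec_of (Mh - M)) \<bullet> (matrix_inv (C ** S ** transpose C) *v (C *v vec_of (Mh - M)))\<bar>
      \<le> \<eta> * (norm (vec_of (Mh - M)))\<^sup>2"
proof (rule ccontr)
  assume not_thesis: "\<not> thesis"
  define dev where "dev U s V UJ Om x = \<bar>vec_of (transpose \<upsilon> ** U) \<bullet>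
          (ginv (B_SVD \<upsilon> U s V UJ ** Om ** transpose (B_SVD \<upsilon> U s V UJ)) *v vec_of (transpose \<upsilon> ** U))
        - (C *v x) \<bullet> (matrix_inv (C ** S ** transpose C) *v (C *v x))\<bar>"
    for U :: "real^'q^'m" and s and V :: "real^'q^'l" and UJ :: "real^'j^'m" and Om x
  have bad: "\<forall>n. \<exists>Mh Om U s V UJ sJ VJ. is_split_svd Mh U s V UJ sJ VJ \<and> dist Mh M \<le> inverse (real (Suc n)) \<and>
      dist Om S \<le> inverse (real (Suc n)) \<and>
      \<eta> * (norm (vec_of (Mh - M)))\<^sup>2 < dev U s V UJ Om (vec_of (Mh - M))"
  proof (rule allI, rule ccontr)
    fix n
    assume no: "\<not> (\<exists>Mh Om U s V UJ sJ VJ. is_split_svd Mh U s V UJ sJ VJ \<and>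
      dist Mh M \<le> inverse (real (Suc n)) \<and> dist Om S \<le> inverse (real (Suc n)) \<and>
      \<eta> * (norm (vec_of (Mh - M)))\<^sup>2 < dev U s V UJ Om (vec_of (Mh - M)))"
    have thesis
    proof (rule that[of "inverse (real (Suc n))"])
      fix Mh Om s V sJ VJ and U :: "real^'q^'m" and UJ :: "real^'j^'m"
      assume "is_split_svd Mh U s V UJ sJ VJ" "dist Mh M \<le> inverse (real (Suc n))"
        "dist Om S \<le> inverse (real (Suc n))"
      with no have "dev U s V UJ Om (vec_of (Mh - M)) \<le> \<eta> * (norm (vec_of (Mh - M)))\<^sup>2"
        unfolding not_ex de_Morgan_conj not_less by blast
      then show "\<bar>vec_of (transpose \<upsilon> ** U) \<bullet>
          (ginv (B_SVD \<upsilon> U s V UJ ** Om ** transpose (B_SVD \<upsilon> U s V UJ)) *v vec_of (transpose \<upsilon> ** U))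
        - (C *v vec_of (Mh - M)) \<bullet> (matrix_inv (C ** S ** transpose C) *v (C *v vec_of (Mh - M)))\<bar>
        \<le> \<eta> * (norm (vec_of (Mh - M)))\<^sup>2" unfolding dev_def .
    qed simp
    with not_thesis show False by simp
  qed
  from bad obtain Mh0 Om0 U0 s0 V0 UJ0 sJ0 VJ0 where seq0:
    "\<And>n. is_split_svd (Mh0 n) (U0 n) (s0 n) (V0 n) (UJ0 n) (sJ0 n) (VJ0 n) \<and>
      dist (Mh0 n) M \<le> inverse (real (Suc n)) \<and> dist (Om0 n) S \<le> inverse (real (Suc n)) \<and>
      \<eta> * (norm (vec_of (Mh0 n - M)))\<^sup>2 < dev (U0 n) (s0 n) (V0 n) (UJ0 n) (Om0 n) (vec_of (Mh0 n - M))"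
    unfolding choice_iff by blast
  have lim0: "X \<longlonglongrightarrow> Y" if "\<And>n. dist (X n) Y \<le> inverse (real (Suc n))"
    for X :: "nat \<Rightarrow> 'z::metric_space" and Y
  proof -
    have "(\<lambda>n. dist (X n) Y) \<longlonglongrightarrow> 0"
      by (rule Lim_null_comparison[OF _ LIMSEQ_inverse_real_of_nat]) (use that in auto)
    then show ?thesis by (rule tendsto_dist_iff[THEN iffD2])
  qed
  have "bounded (range (\<lambda>n. (U0 n, V0 n)))"
  proof (rule boundedI)
    fix p assume "p \<in> range (\<lambda>n. (U0 n, V0 n))"
    then obtain n where p: "p = (U0 n, V0 n)" by auto
    have "norm p \<le> norm (U0 n) + norm (V0 n)" unfolding p by (rule norm_Pair_le)
    also have "\<dots> \<le> real CARD('m) * real CARD('q) + real CARD('l) * real CARD('q)"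
      by (intro add_mono orthonormal_cols_norm split_svdD(1,2)[OF conjunct1[OF seq0]])
    finally show "norm p \<le> real CARD('m) * real CARD('q) + real CARD('l) * real CARD('q)" .
  qed
  then obtain p r where r: "strict_mono r" and p: "((\<lambda>n. (U0 n, V0 n)) \<circ> r) \<longlonglongrightarrow> p"
    using bounded_imp_convergent_subsequence by blast
  define Mh where "Mh = Mh0 \<circ> r"
  define Om where "Om = Om0 \<circ> r"
  define U where "U = U0 \<circ> r"
  define s where "s = s0 \<circ> r"
  define V where "V = V0 \<circ> r"
  define J where "J = UJ0 \<circ> r"
  note subseq_defs = Mh_def Om_def U_def s_def V_def J_def
  have svd: "is_split_svd (Mh n) (U n) (s n) (V n) (J n) ((sJ0 \<circ> r) n) ((VJ0 \<circ> r) n)"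
    and large: "\<eta> * (norm (vec_of (Mh n - M)))\<^sup>2 < dev (U n) (s n) (V n) (J n) (Om n) (vec_of (Mh n - M))" for n
    using seq0[of "r n"] by (simp_all add: subseq_defs)
  have "Mh0 \<longlonglongrightarrow> M" "Om0 \<longlonglongrightarrow> S"
    by (rule lim0, use seq0 in blast)+
  then have Mh: "Mh \<longlonglongrightarrow> M" and Om: "Om \<longlonglongrightarrow> S"
    unfolding Mh_def Om_def using r by (auto intro: LIMSEQ_subseq_LIMSEQ)
  have U: "U \<longlonglongrightarrow> fst p" and V: "V \<longlonglongrightarrow> snd p"
    using tendsto_fst[OF p] tendsto_snd[OF p] by (simp_all add: U_def V_def comp_def)
  obtain s' where s': "s \<longlonglongrightarrow> s'" "\<And>a. 0 < s' $ a" and lim: "transpose (fst p) ** fst p = mat 1"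
    "transpose (snd p) ** snd p = mat 1" "M ** snd p = fst p ** diag s'"
    "transpose (fst p) ** M = diag s' ** transpose (snd p)"
    by (rule split_svd_limit[OF svd Mh U V rank]) blast
  obtain W P where W: "fst p = UI ** W" and P: "diag (\<chi> a. inverse (s' $ a)) ** transpose (snd p) = P ** transpose VI"
    "invertible P" and dist': "\<And>a b. a \<noteq> b \<Longrightarrow> s' $ a \<noteq> s' $ b"
    by (rule split_svd_unique_up_to_rotation[OF svd_M pos distinct lim(1,2) s'(2) lim(3,4)]) blast+
  have null': "transpose \<upsilon> ** fst p = 0"
    by (simp add: W matrix_mul_assoc null matrix_mult_zero)
  have s'0: "s' $ a \<noteq> 0" for a using s'(2)[of a] by simp
  have sq: "(s' $ a)\<^sup>2 \<noteq> (s' $ b)\<^sup>2" if "a \<noteq> b" for a b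
    using dist'[OF that] s'(2)[of a] s'(2)[of b] by (simp add: power2_eq_iff_nonneg)
  define R where "R = P \<otimes>\<^sub>K (mat 1 :: real^'r^'r)"
  have "(matrix_inv P \<otimes>\<^sub>K (mat 1 :: real^'r^'r)) ** R = mat 1"
    by (simp add: R_def kron_mult matrix_inv_left[OF P(2)] kron_mat_1)
  then have R: "invertible R" by (rule matrix_inv_unique)
  have RC: "(diag (\<chi> a. inverse (s' $ a)) ** transpose (snd p)) \<otimes>\<^sub>K transpose \<upsilon> = R ** C"
    by (simp add: P R_def C_def kron_mult)
  define B where "B n = B_SVD \<upsilon> (U n) (s n) (V n) (J n)" for n
  have B: "B \<longlonglongrightarrow> R ** C"
    unfolding B_def RC[symmetric]
    by (rule B_SVD_tendsto[OF U V s'(1) s'0 sq split_svdD(3)[OF svd] null'])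
  define A where "A n = (diag (\<chi> a. inverse (s n $ a)) ** transpose (V n)) \<otimes>\<^sub>K transpose \<upsilon>" for n
  have A: "A \<longlonglongrightarrow> R ** C"
    unfolding A_def RC[symmetric] by (intro tendsto_intros s' V s'0)
  have N: "invertible (C ** S ** transpose C)"
    unfolding C_def
    by (intro pos_def_imp_invertible pos_def_kron_congruence S \<upsilon> split_svdD(2)[OF svd_M])
  have BSB: "(\<lambda>n. B n ** Om n ** transpose (B n)) \<longlonglongrightarrow> (R ** C) ** S ** transpose (R ** C)"
    by (intro tendsto_intros B Om)
  note inv_lim = tendsto_matrix_inv[OF BSB projected_form_invariant(2)[OF R N]]
  define E where "E n = transpose (A n) ** matrix_inv (B n ** Om n ** transpose (B n)) ** A n
      - transpose C ** matrix_inv (C ** S ** transpose C) ** C" for n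
  have "E \<longlonglongrightarrow> transpose (R ** C) ** matrix_inv ((R ** C) ** S ** transpose (R ** C)) ** (R ** C)
      - transpose C ** matrix_inv (C ** S ** transpose C) ** C"
    unfolding E_def by (intro tendsto_intros A inv_lim(1))
  then have E: "E \<longlonglongrightarrow> 0" by (simp add: projected_form_invariant(1)[OF R N])
  obtain K where K: "\<And>(X :: real^('l \<times> 'm)^('l \<times> 'm)) x. norm (X *v x) \<le> norm X * norm x * K"
    using bounded_bilinear.bounded[OF bounded_bilinear_matrix_vector_mult] by blast
  have "(\<lambda>n. norm (E n) * K) \<longlonglongrightarrow> 0"
    using tendsto_mult_left_zero[OF tendsto_norm_zero[OF E]] .
  then have small: "\<forall>\<^sub>F n in sequentially. norm (E n) * K < \<eta>"
    using \<eta> by (rule order_tendstoD)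
  have "\<forall>\<^sub>F n in sequentially. \<forall>a. s n $ a \<noteq> 0"
    by (rule eventually_all_finite) (rule tendsto_imp_eventually_ne[OF tendsto_vec_nth[OF s'(1)] s'0])
  with small inv_lim(2) have "\<forall>\<^sub>F n in sequentially. False"
  proof eventually_elim
    case (elim n)
    define x where "x = vec_of (Mh n - M)"
    have null_M: "transpose \<upsilon> ** M = 0"
    proof -
      have "diag (0::real^'j) = 0" by (simp add: vec_eq_iff diag_def)
      then have "M = UI ** (diag sI ** transpose VI)"
        using svd_M by (simp add: is_split_svd_def matrix_mult_zero matrix_mul_assoc)
      then show ?thesis by (simp add: matrix_mul_assoc null matrix_mult_zero)
    qed
    have d: "vec_of (transpose \<upsilon> ** U n) = A n *v x"
      unfolding A_def x_def using elim(3) by (intro contrast_linear_in_error[OF svd _ null_M]) auto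
    have quad: "(Y *v x) \<bullet> (H *v (Y *v x)) = x \<bullet> ((transpose Y ** H ** Y) *v x)"
      for Y :: "real^('l \<times> 'm)^('q \<times> 'r)" and H
      by (simp only: matrix_vector_mul_assoc[symmetric] inner_mult_vec[of x "transpose Y"] transpose_transpose)
    have "dev (U n) (s n) (V n) (J n) (Om n) x = \<bar>x \<bullet> (E n *v x)\<bar>"
      using elim(2)
      by (simp add: dev_def d B_def[symmetric] ginv_eq_matrix_inv quad E_def
          matrix_vector_mult_diff_rdistrib inner_diff_right)
    also have "\<dots> \<le> norm x * norm (E n *v x)" by (rule Cauchy_Schwarz_ineq2)
    also have "\<dots> \<le> norm x * (norm (E n) * norm x * K)" by (intro mult_left_mono K) simp
    also have "\<dots> = (norm (E n) * K) * (norm x)\<^sup>2" by (simp add: power2_eq_square)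
    also have "\<dots> \<le> \<eta> * (norm x)\<^sup>2" using elim(1) by (intro mult_right_mono) auto
    finally show False using large[of n] by (simp add: x_def)
  qed
  then show False by simp
qed

section \<open>Convergence in distribution under quadratic approximation\<close>

text \<open>The truncated square is the bounded continuous substitute for \<open>\<bar>z\<bar>\<^sup>2\<close> in the two arguments below;
the lemma is dominated convergence as \<open>c\<close> tends to zero.\<close>

lemma small_truncated_square_integral:
  fixes \<mu> :: "'a::euclidean_space measure"
  assumes "prob_space \<mu>" and sets [measurable_cong]: "sets \<mu> = sets borel" and "0 < e"
  obtains c :: real where "0 < c" "(\<integral>z. min 1 (c * (norm z)\<^sup>2) \<partial>\<mu>) < e"
proof -
  interpret prob_space \<mu> by fact
  have "(\<lambda>n. \<integral>z. min 1 (inverse (real (Suc n)) * (norm z)\<^sup>2) \<partial>\<mu>) \<longlonglongrightarrow> (\<integral>z. 0 \<partial>\<mu>)"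
  proof (rule integral_dominated_convergence[where w = "\<lambda>_. 1"])
    show "AE z in \<mu>. (\<lambda>n. min 1 (inverse (real (Suc n)) * (norm z)\<^sup>2)) \<longlonglongrightarrow> 0"
    proof (rule AE_I2)
      fix z
      have "(\<lambda>n. min 1 (inverse (real (Suc n)) * (norm z)\<^sup>2)) \<longlonglongrightarrow> min 1 (0 * (norm z)\<^sup>2)"
        by (intro tendsto_intros LIMSEQ_inverse_real_of_nat)
      then show "(\<lambda>n. min 1 (inverse (real (Suc n)) * (norm z)\<^sup>2)) \<longlonglongrightarrow> 0" by simp
    qed
    show "AE z in \<mu>. norm (min 1 (inverse (real (Suc n)) * (norm z)\<^sup>2)) \<le> 1" for n
      by (auto simp: min_def)
  qed auto
  then have "\<forall>\<^sub>F n in sequentially. (\<integral>z. min 1 (inverse (real (Suc n)) * (norm z)\<^sup>2) \<partial>\<mu>) < e"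
    using \<open>0 < e\<close> by (intro order_tendstoD(2)[of _ 0]) auto
  then obtain n where "(\<integral>z. min 1 (inverse (real (Suc n)) * (norm z)\<^sup>2) \<partial>\<mu>) < e"
    by (auto simp: eventually_sequentially)
  then show thesis by (intro that[of "inverse (real (Suc n))"]) auto
qed

lemma conv_in_distrD:
  fixes f :: "'a::euclidean_space \<Rightarrow> real"
  assumes "conv_in_distr P Z \<mu>" "continuous_on UNIV f" "bounded (range f)"
  shows "(\<lambda>n. \<integral>\<omega>. f (Z n \<omega>) \<partial>P) \<longlonglongrightarrow> (\<integral>z. f z \<partial>\<mu>)"
  using assms(1)[unfolded conv_in_distr_def, rule_format, of f] assms(2,3) by simp

lemma conv_in_distr_truncated_square:
  fixes Z :: "nat \<Rightarrow> 'w \<Rightarrow> 'a::euclidean_space"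
  assumes "conv_in_distr P Z \<mu>" "0 < c"
  shows "(\<lambda>n. \<integral>\<omega>. min 1 (c * (norm (Z n \<omega>))\<^sup>2) \<partial>P) \<longlonglongrightarrow> (\<integral>z. min 1 (c * (norm z)\<^sup>2) \<partial>\<mu>)"
proof -
  have "continuous_on UNIV (\<lambda>z::'a. min 1 (c * (norm z)\<^sup>2))" by (intro continuous_intros)
  moreover have "bounded (range (\<lambda>z::'a. min 1 (c * (norm z)\<^sup>2)))"
    using \<open>0 < c\<close> by (intro boundedI[of _ 1]) (auto simp: min_def)
  ultimately show ?thesis by (rule conv_in_distrD[OF assms(1)])
qed

text \<open>Markov's inequality with \<open>min 1 (c \<bar>z\<bar>\<^sup>2)\<close>: this function is bounded and continuous, so its
expectations converge, and it is at least one as soon as \<open>\<bar>z\<bar> \<ge> 1 / sqrt c\<close>.\<close>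

lemma conv_in_distr_tail_vanishes:
  fixes Z :: "nat \<Rightarrow> 'w \<Rightarrow> 'a::euclidean_space"
  assumes P: "prob_space P" and Z [measurable]: "\<And>n. Z n \<in> borel_measurable P"
    and conv: "conv_in_distr P Z \<mu>" and \<mu>: "prob_space \<mu>" "sets \<mu> = sets borel"
    and a: "filterlim a at_top sequentially"
  shows "(\<lambda>n. measure P {\<omega> \<in> space P. a n < norm (Z n \<omega>)}) \<longlonglongrightarrow> 0"
proof (rule order_tendstoI)
  interpret prob_space P by fact
  fix e :: real assume "0 < e"
  from small_truncated_square_integral[OF \<mu> this] obtain c
    where c: "0 < c" "(\<integral>z. min 1 (c * (norm z)\<^sup>2) \<partial>\<mu>) < e" .
  have "\<forall>\<^sub>F n in sequentially. (\<integral>\<omega>. min 1 (c * (norm (Z n \<omega>))\<^sup>2) \<partial>P) < e"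
    using conv_in_distr_truncated_square[OF conv c(1)] c(2) by (rule order_tendstoD)
  moreover have "\<forall>\<^sub>F n in sequentially. 1 / sqrt c \<le> a n"
    using a by (simp add: filterlim_at_top)
  ultimately show "\<forall>\<^sub>F n in sequentially. measure P {\<omega> \<in> space P. a n < norm (Z n \<omega>)} < e"
  proof eventually_elim
    case (elim n)
    have "measure P {\<omega> \<in> space P. a n < norm (Z n \<omega>)}
        = (\<integral>\<omega>. indicator {\<omega> \<in> space P. a n < norm (Z n \<omega>)} \<omega> \<partial>P)"
      by simp
    also have "\<dots> \<le> (\<integral>\<omega>. min 1 (c * (norm (Z n \<omega>))\<^sup>2) \<partial>P)"
    proof (rule integral_mono)
      show "integrable P (\<lambda>\<omega>. min 1 (c * (norm (Z n \<omega>))\<^sup>2))"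
        using c(1) by (intro integrable_const_bound[of _ 1]) (auto simp: min_def)
      show "integrable P (\<lambda>\<omega>. indicator {\<omega> \<in> space P. a n < norm (Z n \<omega>)} \<omega> :: real)"
        by (intro integrable_real_indicator) (auto simp: emeasure_eq_measure)
      fix \<omega> assume "\<omega> \<in> space P"
      have "1 \<le> c * (norm (Z n \<omega>))\<^sup>2" if "a n < norm (Z n \<omega>)"
      proof -
        have "(1 / sqrt c)\<^sup>2 \<le> (norm (Z n \<omega>))\<^sup>2"
          using elim(2) that c(1) by (intro power_mono) auto
        then show ?thesis using c(1) by (simp add: power_divide field_simps)
      qed
      then show "indicator {\<omega> \<in> space P. a n < norm (Z n \<omega>)} \<omega> \<le> min 1 (c * (norm (Z n \<omega>))\<^sup>2)"
        using c(1) by (auto simp: indicator_def)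
    qed
    finally show ?case using elim(1) by simp
  qed
qed (auto intro!: always_eventually intro: less_le_trans measure_nonneg)

lemma cts_step_lipschitz:
  assumes "x < y"
  shows "\<bar>cts_step x y a - cts_step x y b\<bar> \<le> min 1 (\<bar>a - b\<bar> / (y - x))"
proof -
  have eq: "cts_step x y a = max 0 (min 1 ((y - a) / (y - x)))" for a
    using assms by (auto simp: cts_step_def max_def min_def field_simps)
  have "\<bar>cts_step x y a - cts_step x y b\<bar> \<le> \<bar>(y - a) / (y - x) - (y - b) / (y - x)\<bar>"
    unfolding eq by (simp add: max_def min_def)
  also have "\<dots> = \<bar>a - b\<bar> / (y - x)"
    using assms by (simp add: diff_divide_distrib[symmetric] abs_minus_commute)
  finally show ?thesis unfolding eq by (auto simp: max_def min_def)
qed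

text \<open>A form of Slutsky's lemma for statistics that are almost quadratic in an asymptotically normal error.
The approximation error may grow like \<open>\<bar>Z\<bar>\<^sup>2\<close>: for a Lipschitz test function with values in the unit
interval it contributes at most the expectation of \<open>min 1 (c \<bar>Z\<bar>\<^sup>2)\<close>, which converges and is small
for small \<open>c\<close>. On the exceptional events the test function changes by at most one.\<close>

lemma weak_conv_of_quadratic_approximation:
  fixes Z :: "nat \<Rightarrow> 'w \<Rightarrow> 'a::euclidean_space" and \<phi> :: "'a \<Rightarrow> real"
  assumes P: "prob_space P" and Z [measurable]: "\<And>n. Z n \<in> borel_measurable P"
    and W [measurable]: "\<And>n. W n \<in> borel_measurable P"
    and conv: "conv_in_distr P Z \<mu>" and \<mu>: "prob_space \<mu>" "sets \<mu> = sets borel"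
    and \<phi>: "continuous_on UNIV \<phi>"
    and approx: "\<And>\<eta>. 0 < \<eta> \<Longrightarrow> \<exists>bad. (\<forall>n. bad n \<in> sets P) \<and> (\<lambda>n. measure P (bad n)) \<longlonglongrightarrow> 0 \<and>
      (\<forall>\<^sub>F n in sequentially. \<forall>\<omega>\<in>space P - bad n. \<bar>W n \<omega> - \<phi> (Z n \<omega>)\<bar> \<le> \<eta> * (norm (Z n \<omega>))\<^sup>2)"
  shows "weak_conv_m (\<lambda>n. distr P borel (W n)) (distr \<mu> borel \<phi>)"
proof -
  interpret prob_space P by fact
  interpret \<mu>: prob_space \<mu> by fact
  note \<mu>(2) [measurable_cong]
  have [measurable]: "\<phi> \<in> borel_measurable borel" using \<phi> by (rule borel_measurable_continuous_onI)
  have \<phi>_\<mu> [measurable]: "\<phi> \<in> borel_measurable \<mu>" by measurable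
  show ?thesis
  proof (rule integral_cts_step_conv_imp_weak_conv)
    show "real_distribution (distr P borel (W n))" for n
      by (intro real_distribution.intro prob_space_distr real_distribution_axioms.intro) auto
    show "real_distribution (distr \<mu> borel \<phi>)"
      by (intro real_distribution.intro \<mu>.prob_space_distr real_distribution_axioms.intro) auto
    fix x y :: real assume "x < y"
    let ?g = "cts_step x y"
    have g_cont: "continuous_on UNIV ?g"
      by (rule uniformly_continuous_imp_continuous[OF cts_step_uniformly_continuous[OF \<open>x < y\<close>]])
    have [measurable]: "?g \<in> borel_measurable borel" using g_cont by (rule borel_measurable_continuous_onI)
    have g01: "\<bar>?g a\<bar> \<le> 1" for a using \<open>x < y\<close> by (auto simp: cts_step_def)
    have "continuous_on UNIV (\<lambda>z. ?g (\<phi> z))"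
      by (rule continuous_on_compose2[OF g_cont \<phi>]) auto
    moreover have "bounded (range (\<lambda>z. ?g (\<phi> z)))"
      using g01 by (intro boundedI[of _ 1]) auto
    ultimately have lim: "(\<lambda>n. \<integral>\<omega>. ?g (\<phi> (Z n \<omega>)) \<partial>P) \<longlonglongrightarrow> (\<integral>z. ?g (\<phi> z) \<partial>\<mu>)"
      by (rule conv_in_distrD[OF conv])
    have "(\<lambda>n. (\<integral>\<omega>. ?g (W n \<omega>) \<partial>P) - (\<integral>\<omega>. ?g (\<phi> (Z n \<omega>)) \<partial>P)) \<longlonglongrightarrow> 0"
    proof (rule tendstoI)
      fix e :: real assume "0 < e"
      then have "0 < e / 2" by simp
      from small_truncated_square_integral[OF \<mu> this] obtain c
        where c: "0 < c" "(\<integral>z. min 1 (c * (norm z)\<^sup>2) \<partial>\<mu>) < e / 2" .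
      define \<eta> where "\<eta> = c * (y - x)"
      have "0 < \<eta>" using c(1) \<open>x < y\<close> by (simp add: \<eta>_def)
      from approx[OF this] obtain bad where bad [measurable]: "\<And>n. bad n \<in> sets P"
        and bad_lim: "(\<lambda>n. measure P (bad n)) \<longlonglongrightarrow> 0"
        and close: "\<forall>\<^sub>F n in sequentially. \<forall>\<omega>\<in>space P - bad n. \<bar>W n \<omega> - \<phi> (Z n \<omega>)\<bar> \<le> \<eta> * (norm (Z n \<omega>))\<^sup>2"
        by blast
      have "\<forall>\<^sub>F n in sequentially. measure P (bad n) < e / 2"
        using bad_lim \<open>0 < e / 2\<close> by (rule order_tendstoD)
      moreover have "\<forall>\<^sub>F n in sequentially. (\<integral>\<omega>. min 1 (c * (norm (Z n \<omega>))\<^sup>2) \<partial>P) < e / 2"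
        using conv_in_distr_truncated_square[OF conv c(1)] c(2) by (rule order_tendstoD)
      ultimately show "\<forall>\<^sub>F n in sequentially.
          dist ((\<integral>\<omega>. ?g (W n \<omega>) \<partial>P) - (\<integral>\<omega>. ?g (\<phi> (Z n \<omega>)) \<partial>P)) 0 < e"
        using close
      proof eventually_elim
        case (elim n)
        have int_W: "integrable P (\<lambda>\<omega>. ?g (W n \<omega>))" and int_Z: "integrable P (\<lambda>\<omega>. ?g (\<phi> (Z n \<omega>)))"
          using g01 by (auto intro!: integrable_const_bound[of _ 1])
        have int_c: "integrable P (\<lambda>\<omega>. min 1 (c * (norm (Z n \<omega>))\<^sup>2))"
          using c(1) by (intro integrable_const_bound[of _ 1]) (auto simp: min_def)
        have int_b: "integrable P (\<lambda>\<omega>. indicator (bad n) \<omega> :: real)"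
          by (intro integrable_real_indicator) (auto simp: emeasure_eq_measure)
        have "\<bar>(\<integral>\<omega>. ?g (W n \<omega>) \<partial>P) - (\<integral>\<omega>. ?g (\<phi> (Z n \<omega>)) \<partial>P)\<bar>
            = \<bar>\<integral>\<omega>. ?g (W n \<omega>) - ?g (\<phi> (Z n \<omega>)) \<partial>P\<bar>"
          using int_W int_Z by simp
        also have "\<dots> \<le> (\<integral>\<omega>. \<bar>?g (W n \<omega>) - ?g (\<phi> (Z n \<omega>))\<bar> \<partial>P)"
          by (rule integral_abs_bound)
        also have "\<dots> \<le> (\<integral>\<omega>. min 1 (c * (norm (Z n \<omega>))\<^sup>2) + indicator (bad n) \<omega> \<partial>P)"
        proof (rule integral_mono)
          fix \<omega> assume \<omega>: "\<omega> \<in> space P"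
          note lip = cts_step_lipschitz[OF \<open>x < y\<close>, of "W n \<omega>" "\<phi> (Z n \<omega>)"]
          show "\<bar>?g (W n \<omega>) - ?g (\<phi> (Z n \<omega>))\<bar> \<le> min 1 (c * (norm (Z n \<omega>))\<^sup>2) + indicator (bad n) \<omega>"
          proof (cases "\<omega> \<in> bad n")
            case True
            have "0 \<le> min 1 (c * (norm (Z n \<omega>))\<^sup>2)" using c(1) by simp
            moreover have "\<bar>?g (W n \<omega>) - ?g (\<phi> (Z n \<omega>))\<bar> \<le> 1" using lip by simp
            ultimately show ?thesis unfolding indicator_simps(1)[OF True] by linarith
          next
            case False
            then have "\<bar>W n \<omega> - \<phi> (Z n \<omega>)\<bar> \<le> (c * (norm (Z n \<omega>))\<^sup>2) * (y - x)"
              using elim(3) \<omega> by (simp add: \<eta>_def mult_ac)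
            then have "\<bar>W n \<omega> - \<phi> (Z n \<omega>)\<bar> / (y - x) \<le> c * (norm (Z n \<omega>))\<^sup>2"
              using \<open>x < y\<close> by (simp add: pos_divide_le_eq)
            then show ?thesis using lip False by auto
          qed
        qed (use int_W int_Z int_c int_b in auto)
        also have "\<dots> = (\<integral>\<omega>. min 1 (c * (norm (Z n \<omega>))\<^sup>2) \<partial>P) + measure P (bad n)"
          using int_c int_b by simp
        finally show ?case using elim(1,2) by (simp add: dist_real_def)
      qed
    qed
    from tendsto_add[OF this lim]
    show "(\<lambda>n. integral\<^sup>L (distr P borel (W n)) ?g) \<longlonglongrightarrow> integral\<^sup>L (distr \<mu> borel \<phi>) ?g"
      by (simp add: integral_distr)
  qed
qed

section \<open>The limit law of the Wald statistic\<close>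

lemma norm_vec_of: "norm (vec_of A) = norm A"
proof -
  have "vec_of A \<bullet> vec_of A = A \<bullet> A"
    unfolding inner_vec_def vec_of_def
    by (subst sum.swap) (simp add: sum.cartesian_product UNIV_Times_UNIV[symmetric] case_prod_beta del: UNIV_Times_UNIV)
  then show ?thesis by (simp add: norm_eq_sqrt_inner)
qed

text \<open>Testing convergence in distribution with the constant function one shows that the limit has total mass
one, which spares the evaluation of the Gaussian integral.\<close>

lemma emeasure_mvn_eq_1:
  assumes P: "prob_space P" and conv: "conv_in_distr P Z (mvn S)"
  shows "emeasure (mvn S) UNIV = 1"
proof -
  interpret prob_space P by fact
  have "bounded (range (\<lambda>_. 1 :: real))" by simp
  from conv_in_distrD[OF conv continuous_on_const this]
  have "(\<lambda>n. \<integral>\<omega>. (1::real) \<partial>P) \<longlonglongrightarrow> (\<integral>z. 1 \<partial>mvn S)" .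
  then have "(\<integral>z. 1 \<partial>mvn S) = (1 :: real)"
    by (simp add: LIMSEQ_const_iff prob_space)
  then have "measure (mvn S) UNIV = 1" by (simp add: mvn_def)
  then show ?thesis by (simp add: measure_def)
qed

lemma borel_measurable_D_d [measurable]: "(D_d :: real^'q \<Rightarrow> _) \<in> borel_measurable borel"
  unfolding D_d_def
proof (intro borel_measurable_vecI)
  fix i j :: "'q::finite"
  show "(\<lambda>s :: real^'q. (\<chi> i j. if i = j then 0 else inverse ((s $ i)\<^sup>2 - (s $ j)\<^sup>2)) $ i $ j) \<in> borel_measurable borel"
    by (cases "i = j") auto
qed

text \<open>Convergence in distribution is stated for image measures, which are meaningful only for measurable
statistics; this is where measurability of the generalized inverse on all matrices is used.\<close>

lemma borel_measurable_W_SVD: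
  fixes \<upsilon> :: "real^'r^'m" and UI :: "'w \<Rightarrow> real^'q^'m" and UJ :: "'w \<Rightarrow> real^'j^'m"
  assumes [measurable]: "UI \<in> borel_measurable N" "s \<in> borel_measurable N" "V \<in> borel_measurable N"
    "UJ \<in> borel_measurable N" "Om \<in> borel_measurable N"
  shows "(\<lambda>\<omega>. W_SVD T \<upsilon> (UI \<omega>) (s \<omega>) (V \<omega>) (UJ \<omega>) (Om \<omega>)) \<in> borel_measurable N"
proof -
  have [measurable]: "(\<lambda>\<omega>. B_SVD \<upsilon> (UI \<omega>) (s \<omega>) (V \<omega>) (UJ \<omega>)) \<in> borel_measurable N"
    unfolding B_SVD_def by measurable
  show ?thesis unfolding W_SVD_def Let_def by measurable
qed

theorem theorem2:
  fixes P :: "'w measure"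
    and M :: "real^'l^'m"
    and UI :: "real^'q^'m" and sI :: "real^'q" and VI :: "real^'q^'l"
    and UJ :: "real^'j^'m" and VJ :: "real^'j^'l"
    and \<Omega> :: "real^('l \<times> 'm)^('l \<times> 'm)"
    and \<epsilon> Mt :: "nat \<Rightarrow> 'w \<Rightarrow> real^'l^'m"
    and \<Omega>h :: "nat \<Rightarrow> 'w \<Rightarrow> real^('l \<times> 'm)^('l \<times> 'm)"
    and UIh :: "nat \<Rightarrow> 'w \<Rightarrow> real^'q^'m" and sIh :: "nat \<Rightarrow> 'w \<Rightarrow> real^'q"
    and VIh :: "nat \<Rightarrow> 'w \<Rightarrow> real^'q^'l"
    and UJh :: "nat \<Rightarrow> 'w \<Rightarrow> real^'j^'m" and sJh :: "nat \<Rightarrow> 'w \<Rightarrow> real^'j"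
    and VJh :: "nat \<Rightarrow> 'w \<Rightarrow> real^'j^'l"
    and \<upsilon> :: "real^'r^'m" and h :: nat
  assumes prob: "prob_space P"
    and dims: "CARD('m) \<le> CARD('l)"
    and rank_M: "rank M = CARD('q)"
    and svd_M: "is_split_svd M UI sI VI UJ 0 VJ"
    and sI_pos: "\<And>a. 0 < sI $ a"
    and sI_distinct: "\<And>a b. a \<noteq> b \<Longrightarrow> sI $ a \<noteq> sI $ b"
    and Mt_eq: "\<And>t \<omega>. 1 \<le> t \<Longrightarrow> \<omega> \<in> space P \<Longrightarrow> Mt t \<omega> = M + \<epsilon> t \<omega>"
    and \<epsilon>_meas: "\<And>t. 1 \<le> t \<Longrightarrow> \<epsilon> t \<in> borel_measurable P"
    and \<epsilon>_ident: "\<And>t. 1 \<le> t \<Longrightarrow>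
          distr P borel (\<lambda>\<omega>. vec_of (\<epsilon> t \<omega>)) = distr P borel (\<lambda>\<omega>. vec_of (\<epsilon> 1 \<omega>))"
    and \<epsilon>_integrable: "\<And>t. 1 \<le> t \<Longrightarrow> integrable P (\<lambda>\<omega>. vec_of (\<epsilon> t \<omega>))"
    and \<epsilon>_mean: "\<And>t. 1 \<le> t \<Longrightarrow> (\<integral>\<omega>. vec_of (\<epsilon> t \<omega>) \<partial>P) = 0"
    and \<epsilon>_sq_integrable: "\<And>t. 1 \<le> t \<Longrightarrow>
          integrable P (\<lambda>\<omega>. outer (vec_of (\<epsilon> t \<omega>)) (vec_of (\<epsilon> t \<omega>)))"
    and \<epsilon>_cov: "\<And>t. 1 \<le> t \<Longrightarrow>
          (\<integral>\<omega>. outer (vec_of (\<epsilon> t \<omega>)) (vec_of (\<epsilon> t \<omega>)) \<partial>P) = \<Omega>"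
    and \<Omega>_pos_def: "pos_def \<Omega>"
    and clt: "conv_in_distr P
          (\<lambda>T \<omega>. sqrt (real T) *\<^sub>R vec_of (sample_mean Mt T \<omega> - M)) (mvn \<Omega>)"
    and \<Omega>h_meas: "\<And>T. \<Omega>h T \<in> borel_measurable P"
    and \<Omega>h_consistent: "conv_in_prob P \<Omega>h \<Omega>"
    and svd_sample: "\<And>T \<omega>. 1 \<le> T \<Longrightarrow> \<omega> \<in> space P \<Longrightarrow>
          is_split_svd (sample_mean Mt T \<omega>)
            (UIh T \<omega>) (sIh T \<omega>) (VIh T \<omega>) (UJh T \<omega>) (sJh T \<omega>) (VJh T \<omega>)"
    and svd_meas: "\<And>T. UIh T \<in> borel_measurable P" "\<And>T. sIh T \<in> borel_measurable P"
          "\<And>T. VIh T \<in> borel_measurable P" "\<And>T. UJh T \<in> borel_measurable P"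
    and h_le: "h \<le> CARD('q)"
    and card_r: "CARD('r) = CARD('m) - h"
    and \<upsilon>_rank: "rank \<upsilon> = CARD('r)"
    and null_hyp: "transpose \<upsilon> ** UI = 0"
  shows "weak_conv_m
      (\<lambda>T. distr P borel
        (\<lambda>\<omega>. W_SVD T \<upsilon> (UIh T \<omega>) (sIh T \<omega>) (VIh T \<omega>) (UJh T \<omega>) (\<Omega>h T \<omega>)))
      (chi_squared (CARD('q) * (CARD('m) - h)))"
proof -
  interpret prob_space P by (rule prob)
  define C where "C = transpose VI \<otimes>\<^sub>K transpose \<upsilon>"
  define \<phi> where "\<phi> x = (C *v x) \<bullet> (matrix_inv (C ** \<Omega> ** transpose C) *v (C *v x))" for x
  define Z where "Z T \<omega> = sqrt (real T) *\<^sub>R vec_of (sample_mean Mt T \<omega> - M)" for T \<omega>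
  define W where "W T \<omega> = W_SVD T \<upsilon> (UIh T \<omega>) (sIh T \<omega>) (VIh T \<omega>) (UJh T \<omega>) (\<Omega>h T \<omega>)" for T \<omega>
  have conv: "conv_in_distr P Z (mvn \<Omega>)" using clt by (simp add: Z_def[abs_def])
  have mass: "emeasure (mvn \<Omega>) UNIV = 1" by (rule emeasure_mvn_eq_1[OF prob conv])
  have sets_mvn: "sets (mvn \<Omega>) = sets borel" by (simp add: mvn_def)
  have prob_mvn: "prob_space (mvn \<Omega>)" using mass by (intro prob_spaceI) (simp add: mvn_def)
  have mean_meas [measurable]: "sample_mean Mt T \<in> borel_measurable P" for T
  proof -
    have "(\<lambda>\<omega>. (1 / real T) *\<^sub>R (\<Sum>t = 1..T. M + \<epsilon> t \<omega>)) \<in> borel_measurable P"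
      by (intro borel_measurable_scaleR borel_measurable_sum borel_measurable_add borel_measurable_const \<epsilon>_meas) auto
    then show ?thesis
      by (rule measurable_cong[THEN iffD1, rotated]) (simp add: sample_mean_def Mt_eq)
  qed
  have Z_meas: "Z T \<in> borel_measurable P" for T unfolding Z_def by measurable
  have W_meas: "W T \<in> borel_measurable P" for T
    unfolding W_def by (intro borel_measurable_W_SVD svd_meas \<Omega>h_meas)
  have Z_norm: "norm (Z T \<omega>) = sqrt (real T) * dist (sample_mean Mt T \<omega>) M" for T \<omega>
    by (simp add: Z_def norm_vec_of dist_norm)
  have "continuous_on UNIV \<phi>"
    unfolding \<phi>_def by (intro continuous_intros bounded_linear.continuous_on[OF matrix_vector_mul_bounded_linear])
  have "weak_conv_m (\<lambda>T. distr P borel (W T)) (distr (mvn \<Omega>) borel \<phi>)"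
  proof (rule weak_conv_of_quadratic_approximation[OF prob Z_meas W_meas conv prob_mvn sets_mvn \<open>continuous_on UNIV \<phi>\<close>])
    fix \<eta> :: real assume "0 < \<eta>"
    from statistic_uniform_approximation[OF rank_M svd_M sI_pos sI_distinct \<Omega>_pos_def \<upsilon>_rank null_hyp this]
    obtain \<delta> where "0 < \<delta>" and \<delta>: "\<And>Mh Om (U :: real^'q^'m) s V (UJ :: real^'j^'m) sJ VJ.
      is_split_svd Mh U s V UJ sJ VJ \<Longrightarrow> dist Mh M \<le> \<delta> \<Longrightarrow> dist Om \<Omega> \<le> \<delta> \<Longrightarrow>
      \<bar>vec_of (transpose \<upsilon> ** U) \<bullet>
          (ginv (B_SVD \<upsilon> U s V UJ ** Om ** transpose (B_SVD \<upsilon> U s V UJ)) *v vec_of (transpose \<upsilon> ** U))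
        - \<phi> (vec_of (Mh - M))\<bar> \<le> \<eta> * (norm (vec_of (Mh - M)))\<^sup>2"
      unfolding \<phi>_def C_def by blast
    define bad1 where "bad1 T = {\<omega> \<in> space P. \<delta> < dist (sample_mean Mt T \<omega>) M}" for T
    define bad2 where "bad2 T = {\<omega> \<in> space P. \<delta> < dist (\<Omega>h T \<omega>) \<Omega>}" for T
    have bad_sets [measurable]: "bad1 T \<in> sets P" "bad2 T \<in> sets P" for T
      using mean_meas[of T] \<Omega>h_meas[of T] unfolding bad1_def bad2_def by measurable
    (* The sample mean is consistent because its error is Z / sqrt T with Z tight. *)
    have "(\<lambda>T. measure P {\<omega> \<in> space P. sqrt (real T) * \<delta> < norm (Z T \<omega>)}) \<longlonglongrightarrow> 0"
    proof (rule conv_in_distr_tail_vanishes[OF prob Z_meas conv prob_mvn sets_mvn])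
      show "filterlim (\<lambda>T. sqrt (real T) * \<delta>) at_top sequentially"
        using \<open>0 < \<delta>\<close>
        by (intro filterlim_at_top_mult_tendsto_pos[where c = \<delta>] tendsto_const
            filterlim_compose[OF sqrt_at_top filterlim_real_sequentially])
    qed
    then have "(\<lambda>T. measure P (bad1 T)) \<longlonglongrightarrow> 0"
    proof (rule Lim_transform_eventually)
      show "\<forall>\<^sub>F T in sequentially. measure P {\<omega> \<in> space P. sqrt (real T) * \<delta> < norm (Z T \<omega>)} = measure P (bad1 T)"
        using eventually_gt_at_top[of 0] by eventually_elim (simp add: bad1_def Z_norm)
    qed
    moreover have "(\<lambda>T. measure P (bad2 T)) \<longlonglongrightarrow> 0"
      using \<Omega>h_consistent \<open>0 < \<delta>\<close> by (simp add: bad2_def conv_in_prob_def)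
    ultimately have sum0: "(\<lambda>T. measure P (bad1 T) + measure P (bad2 T)) \<longlonglongrightarrow> 0"
      using tendsto_add by fastforce
    have "(\<lambda>T. measure P (bad1 T \<union> bad2 T)) \<longlonglongrightarrow> 0"
      by (rule Lim_null_comparison[OF _ sum0]) (auto intro!: always_eventually measure_Un_le)
    moreover have "\<forall>\<^sub>F T in sequentially. \<forall>\<omega>\<in>space P - (bad1 T \<union> bad2 T).
        \<bar>W T \<omega> - \<phi> (Z T \<omega>)\<bar> \<le> \<eta> * (norm (Z T \<omega>))\<^sup>2"
      using eventually_ge_at_top[of 1]
    proof eventually_elim
      case (elim T)
      show ?case
      proof
        fix \<omega> assume \<omega>: "\<omega> \<in> space P - (bad1 T \<union> bad2 T)"
        define x where "x = vec_of (sample_mean Mt T \<omega> - M)"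
        define B where "B = B_SVD \<upsilon> (UIh T \<omega>) (sIh T \<omega>) (VIh T \<omega>) (UJh T \<omega>)"
        define d where "d = vec_of (transpose \<upsilon> ** UIh T \<omega>)"
        have \<phi>_Z: "\<phi> (Z T \<omega>) = real T * \<phi> x"
          by (simp add: \<phi>_def Z_def x_def matrix_vector_mult_scaleR flip: mult.assoc)
        have "\<bar>d \<bullet> (ginv (B ** \<Omega>h T \<omega> ** transpose B) *v d) - \<phi> x\<bar> \<le> \<eta> * (norm x)\<^sup>2"
          unfolding d_def B_def x_def
          using \<omega> elim by (intro \<delta>[OF svd_sample]) (auto simp: bad1_def bad2_def not_less)
        then have "real T * \<bar>d \<bullet> (ginv (B ** \<Omega>h T \<omega> ** transpose B) *v d) - \<phi> x\<bar> \<le> real T * (\<eta> * (norm x)\<^sup>2)"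
          by (rule mult_left_mono) simp
        moreover have "W T \<omega> - \<phi> (Z T \<omega>)
            = real T * (d \<bullet> (ginv (B ** \<Omega>h T \<omega> ** transpose B) *v d) - \<phi> x)"
          by (simp add: W_def W_SVD_def Let_def \<phi>_Z right_diff_distrib flip: B_def d_def)
        moreover have "(norm (Z T \<omega>))\<^sup>2 = real T * (norm x)\<^sup>2"
          by (simp add: Z_def x_def power_mult_distrib)
        ultimately show "\<bar>W T \<omega> - \<phi> (Z T \<omega>)\<bar> \<le> \<eta> * (norm (Z T \<omega>))\<^sup>2"
          by (simp add: abs_mult mult_ac)
      qed
    qed
    ultimately show "\<exists>bad. (\<forall>T. bad T \<in> sets P) \<and> (\<lambda>T. measure P (bad T)) \<longlonglongrightarrow> 0 \<and>
      (\<forall>\<^sub>F T in sequentially. \<forall>\<omega>\<in>space P - bad T. \<bar>W T \<omega> - \<phi> (Z T \<omega>)\<bar> \<le> \<eta> * (norm (Z T \<omega>))\<^sup>2)"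
      by (intro exI[of _ "\<lambda>T. bad1 T \<union> bad2 T"]) auto
  qed
  moreover have "distr (mvn \<Omega>) borel \<phi> = chi_squared (CARD('q) * (CARD('m) - h))"
  proof -
    have "pos_def (C ** \<Omega> ** transpose C)"
      unfolding C_def by (rule pos_def_kron_congruence[OF \<Omega>_pos_def split_svdD(2)[OF svd_M] \<upsilon>_rank])
    from distr_mvn_quadratic_form[OF \<Omega>_pos_def this mass] show ?thesis
      by (simp add: \<phi>_def[abs_def] card_r)
  qed
  ultimately show ?thesis by (simp add: W_def[abs_def])
qed

end
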